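(* If $T$ is a 1-point lattice tetrahedron, then $T$ is equivalent to one of $T_{3,3,4}$, $T_{2,2,5}$, $T_{2,4,7}$, $T_{2,6,11}$, $T_{2,7,13}$, $T_{2,9,17}$, $T_{2,13,19}$, $T_{3,7,20}$.
   Context: A lattice tetrahedron is a non-degenerate tetrahedron with vertices in $\mathbb{Z}^3$; it is clean if the only lattice points on its boundary are its vertices. A 1-point lattice tetrahedron is a clean lattice tetrahedron with exactly one lattice point in its interior. For $(a,b,n)\in\mathbb{Z}^3$, $n\ne0$, $T_{a,b,n}$ is the tetrahedron with vertices $(0,0,0),(1,0,0),(0,1,0),(a,b,n)$. Two lattice tetrahedra are equivalent if some map $v\mapsto Mv+u$ with $M\in M_3(\mathbb{Z})$, $\det M=\pm1$, $u\in\mathbb{Z}^3$ maps the vertex set of one onto the vertex set of the other (in any order). *)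

theory Defs
  imports "HOL-Analysis.Analysis"
begin

definition int_lattice :: "(real^3) set" where
  "int_lattice = {x. \<forall>i. x $ i \<in> \<int>}"

text \<open>A tetrahedron is the solid body, that is a library 3-simplex (the convex hull of four
  affinely independent points), and its vertices are its extreme points.\<close>

definition vertices :: "(real^3) set \<Rightarrow> (real^3) set" where
  "vertices T = {v. v extreme_point_of T}"

definition lattice_tetrahedron :: "(real^3) set \<Rightarrow> bool" where
  "lattice_tetrahedron T \<longleftrightarrow> 3 simplex T \<and> vertices T \<subseteq> int_lattice"

definition clean_tetrahedron :: "(real^3) set \<Rightarrow> bool" where
  "clean_tetrahedron T \<longleftrightarrow> lattice_tetrahedron T \<and> frontier T \<inter> int_lattice = vertices T"

definition one_point_lattice_tetrahedron :: "(real^3) set \<Rightarrow> bool" where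
  "one_point_lattice_tetrahedron T \<longleftrightarrow>
     clean_tetrahedron T \<and> (\<exists>!x. x \<in> interior T \<inter> int_lattice)"

definition tetra :: "int \<Rightarrow> int \<Rightarrow> int \<Rightarrow> (real^3) set" where
  "tetra a b n = convex hull
     {vector [0, 0, 0], vector [1, 0, 0], vector [0, 1, 0],
      vector [of_int a, of_int b, of_int n]}"

definition lattice_equivalent :: "(real^3) set \<Rightarrow> (real^3) set \<Rightarrow> bool" where
  "lattice_equivalent S T \<longleftrightarrow>
     (\<exists>(M :: real^3^3) (u :: real^3).
        (\<forall>i j. M $ i $ j \<in> \<int>) \<and> (det M = 1 \<or> det M = -1) \<and> u \<in> int_lattice \<and>
        (\<lambda>v. M *v v + u) ` vertices S = vertices T)"

end

theory Submission
  imports Defs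
begin

text \<open>Write lattice points as combinations of the vertices with integer coefficient sum; modulo
  \<open>\<int>\<^sup>4\<close> this gives a finite group, in which an element whose fractional parts sum to 1 is the interior
  point \<open>l\<close>. Hence every element with one integral coordinate is 0, the group is cyclic, and the
  fractional parts of any element except 0 and \<open>\<plusminus>l\<close> sum to 2.

  Applied to the multiples of \<open>l\<close>, this says that \<open>\<Sum>\<lfloor>k l\<^sub>i\<rfloor> = k - 2\<close> for
  \<open>2 \<le> k \<le> h - 2\<close>, where \<open>h\<close> is the order of \<open>l\<close>. A finite search over the possible floors shows \<open>h \<le> 19\<close>
  and leaves seven vectors \<open>l\<close>. Applied to the cosets of \<open>l\<close>, it bounds in the same way the index of the
  subgroup generated by \<open>l\<close>, and the only proper extension is of index 5, for \<open>l = (1/4, 1/4, 1/4, 1/4)\<close>.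
  The group determines the tetrahedron up to equivalence.\<close>

subsection \<open>Searching for real vectors with prescribed floors\<close>

text \<open>The box \<open>((a, b), (c, d))\<close> stands for the open interval from \<open>a / b\<close> to \<open>c / d\<close>, with positive
  denominators.\<close>

type_synonym box = "(int \<times> int) \<times> (int \<times> int)"

fun in_box :: "real \<Rightarrow> box \<Rightarrow> bool" where
  "in_box y ((a, b), (c, d)) \<longleftrightarrow> 0 < b \<and> 0 < d \<and> of_int a < of_int b * y \<and> of_int d * y < of_int c"

text \<open>The candidates for the floor of \<open>k * y\<close>. The \<open>- 1\<close> reflects
  that the box is open: a floor z at the upper end must satisfy \<open>z * d < k * c\<close>
  strictly.\<close>

fun cells :: "int \<Rightarrow> box \<Rightarrow> int list" where
  "cells k ((a, b), (c, d)) = [k * a div b .. (k * c - 1) div d]"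

text \<open>Intersects the box with the open interval from z / k to (z + 1) / k, comparing fractions
  by cross-multiplication. The open left end is sound because the search is used only where
  \<open>k * y\<close> is not an integer.\<close>

fun refine :: "int \<Rightarrow> int \<Rightarrow> box \<Rightarrow> box" where
  "refine k z ((a, b), (c, d)) =
     (if a * k < z * b then (z, k) else (a, b), if (z + 1) * d < c * k then (z + 1, k) else (c, d))"

fun fraction_sum :: "(int \<times> int) list \<Rightarrow> int \<times> int" where
  "fraction_sum [] = (0, 1)"
| "fraction_sum ((a, b) # fs) = (case fraction_sum fs of (p, q) \<Rightarrow> (a * q + p * b, b * q))"

definition feasible :: "int \<Rightarrow> box list \<Rightarrow> bool" where
  "feasible S bs \<longleftrightarrow> (case fraction_sum (map fst bs) of (p, q) \<Rightarrow> p < S * q) \<and>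
     (case fraction_sum (map snd bs) of (p, q) \<Rightarrow> S * q < p)"

text \<open>The predicate is passed along as a continuation, so that the product of the lists is
  never built.\<close>

primrec ex_cells :: "int list list \<Rightarrow> (int list \<Rightarrow> bool) \<Rightarrow> bool" where
  "ex_cells [] Q = Q []"
| "ex_cells (xs # xss) Q = list_ex (\<lambda>x. ex_cells xss (\<lambda>zs. Q (x # zs))) xs"

text \<open>\<open>alive P S d k bs\<close> fails only if no list of reals \<open>ys\<close> in the boxes \<open>bs\<close> with sum \<open>S\<close> has
  floors of \<open>j * ys\<close> that satisfy \<open>P j\<close> for all \<open>k \<le> j < k + d\<close>: fixing the floors at one level shrinks the
  boxes, and the sum constraint prunes.\<close>

primrec alive :: "(int \<Rightarrow> int list \<Rightarrow> bool) \<Rightarrow> int \<Rightarrow> nat \<Rightarrow> int \<Rightarrow> box list \<Rightarrow> bool" where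
  "alive P S 0 k bs = True"
| "alive P S (Suc d) k bs = ex_cells (map (cells k) bs) (\<lambda>zs. P k zs \<and> (let bs' = map2 (refine k) zs bs in
     feasible S bs' \<and> alive P S d (k + 1) bs'))"

lemma floor_in_cells:
  assumes "in_box y B" "0 < k"
  shows "\<lfloor>of_int k * y\<rfloor> \<in> set (cells k B)"
proof -
  obtain a b c d where B: "B = ((a, b), (c, d))" by (metis surj_pair)
  with assms have *: "0 < b" "0 < d" "of_int a < of_int b * y" "of_int d * y < of_int c" by auto
  have "of_int (k * a) / of_int b \<le> of_int k * y"
    using * assms(2) by (simp add: divide_le_eq algebra_simps mult_left_mono less_imp_le)
  then have 1: "k * a div b \<le> \<lfloor>of_int k * y\<rfloor>"
    by (metis floor_divide_of_int_eq floor_mono)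
  have "of_int d * of_int \<lfloor>of_int k * y\<rfloor> \<le> of_int d * (of_int k * y)"
    using * by (intro mult_left_mono) auto
  also have "\<dots> = of_int k * (of_int d * y)" by simp
  also have "\<dots> < of_int k * of_int c"
    using * assms(2) by (intro mult_strict_left_mono) auto
  finally have "of_int (d * \<lfloor>of_int k * y\<rfloor>) < (of_int (k * c) :: real)" by simp
  then have "d * \<lfloor>of_int k * y\<rfloor> \<le> k * c - 1" by linarith
  then have "\<lfloor>of_int k * y\<rfloor> \<le> (k * c - 1) div d"
    using * by (metis mult.commute zdiv_mono1 nonzero_mult_div_cancel_right less_irrefl)
  with 1 B show ?thesis by simp
qed

lemma in_box_refine:
  assumes "in_box y B" "0 < k" "of_int k * y \<notin> \<int>"
  shows "in_box y (refine k \<lfloor>of_int k * y\<rfloor> B)"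
proof -
  obtain a b c d where B: "B = ((a, b), (c, d))" by (metis surj_pair)
  have "of_int \<lfloor>of_int k * y\<rfloor> < of_int k * y"
    using assms(3) by (metis Ints_of_int of_int_floor_le order_le_less)
  moreover have "of_int k * y < of_int \<lfloor>of_int k * y\<rfloor> + 1"
    by linarith
  ultimately show ?thesis using assms B by auto
qed

text \<open>The strict bound fails for the empty list, so the induction runs on the weak bound and
  gains strictness from the head.\<close>

lemma fraction_sum_less:
  assumes "list_all2 (\<lambda>(y::real) (a, b). 0 < b \<and> of_int a < of_int b * y) ys fs"
    and "fraction_sum fs = (p, q)"
  shows "0 < q \<and> of_int p \<le> of_int q * sum_list ys \<and> (ys \<noteq> [] \<longrightarrow> of_int p < of_int q * sum_list ys)"
  using assms
proof (induction arbitrary: p q rule: list_all2_induct)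
  case (Cons y ys f fs)
  obtain a b where f: "f = (a, b)" by (metis surj_pair)
  obtain r s where rs: "fraction_sum fs = (r, s)" by (metis surj_pair)
  have IH: "0 < s" "of_int r \<le> of_int s * sum_list ys" using Cons.IH[OF rs] by auto
  have ab: "0 < b" "of_int a < of_int b * y" using Cons.hyps f by auto
  have pq: "p = a * s + r * b" "q = b * s" using Cons.prems f rs by auto
  have "of_int a * of_int s < (of_int b * y) * of_int s"
    using ab IH by (intro mult_strict_right_mono) auto
  moreover have "of_int r * of_int b \<le> (of_int s * sum_list ys) * of_int b"
    using ab IH by (intro mult_right_mono) auto
  ultimately have "of_int a * of_int s + of_int r * of_int b <
      (of_int b * y) * of_int s + (of_int s * sum_list ys) * of_int b"
    by (rule add_less_le_mono)
  then have "of_int p < of_int q * sum_list (y # ys)"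
    unfolding pq by (simp add: algebra_simps)
  with ab IH pq show ?case by simp
qed auto

lemma fraction_sum_greater:
  assumes "list_all2 (\<lambda>(y::real) (a, b). 0 < b \<and> of_int b * y < of_int a) ys fs"
    and "fraction_sum fs = (p, q)"
  shows "0 < q \<and> of_int q * sum_list ys \<le> of_int p \<and> (ys \<noteq> [] \<longrightarrow> of_int q * sum_list ys < of_int p)"
proof -
  \<comment> \<open>Changing the sign of the reals and the numerators turns upper bounds into lower
    bounds.\<close>
  have neg: "fraction_sum (map (map_prod uminus id) fs) = map_prod uminus id (fraction_sum fs)" for fs
    by (induction fs rule: fraction_sum.induct) (auto split: prod.splits)
  have "list_all2 (\<lambda>(y::real) (a, b). 0 < b \<and> of_int a < of_int b * y) (map uminus ys) (map (map_prod uminus id) fs)"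
    using assms(1) by (auto simp: list_all2_map1 list_all2_map2 elim!: list_all2_mono)
  from fraction_sum_less[OF this, of "- p" q] neg[of fs] assms(2)
  have "0 < q \<and> - of_int p \<le> of_int q * sum_list (map uminus ys) \<and>
      (ys \<noteq> [] \<longrightarrow> - of_int p < of_int q * sum_list (map uminus ys))"
    by simp
  moreover have "sum_list (map uminus ys) = - sum_list ys"
    by (induction ys) auto
  ultimately show ?thesis by simp
qed

lemma feasibleI:
  assumes "list_all2 in_box ys bs" "sum_list ys = of_int S" "ys \<noteq> []"
  shows "feasible S bs"
proof -
  obtain p q where pq: "fraction_sum (map fst bs) = (p, q)" by (metis surj_pair)
  obtain r s where rs: "fraction_sum (map snd bs) = (r, s)" by (metis surj_pair)
  have "list_all2 (\<lambda>(y::real) (a, b). 0 < b \<and> of_int a < of_int b * y) ys (map fst bs)"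
    "list_all2 (\<lambda>(y::real) (a, b). 0 < b \<and> of_int b * y < of_int a) ys (map snd bs)"
    using assms(1) by (auto simp: list_all2_conv_all_nth elim!: in_box.elims)
  from fraction_sum_less[OF this(1) pq] fraction_sum_greater[OF this(2) rs] assms(2,3)
  have "(of_int p::real) < of_int (S * q)" "(of_int (S * s)::real) < of_int r" by (auto simp: mult.commute)
  then have "p < S * q" "S * s < r" by linarith+
  then show ?thesis by (simp add: feasible_def pq rs)
qed

lemma ex_cells_iff: "ex_cells xss Q \<longleftrightarrow> (\<exists>zs. list_all2 (\<lambda>z xs. z \<in> set xs) zs xss \<and> Q zs)"
  by (induction xss arbitrary: Q) (auto simp: list_ex_iff list_all2_Cons2)

text \<open>The branch of the actual floors is never pruned: the point stays in the refined boxes,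
  and its sum keeps them feasible. Used contrapositively, a failed search excludes the
  point.\<close>

lemma aliveI:
  assumes "\<And>j. k \<le> j \<Longrightarrow> j < k + int d \<Longrightarrow> P j (map (\<lambda>y. \<lfloor>of_int j * y\<rfloor>) ys)"
    and "\<And>j y. k \<le> j \<Longrightarrow> j < k + int d \<Longrightarrow> y \<in> set ys \<Longrightarrow> of_int j * y \<notin> \<int>"
    and "list_all2 in_box ys bs" "sum_list ys = of_int S" "ys \<noteq> []" "0 < k"
  shows "alive P S d k bs"
  using assms
proof (induction d arbitrary: k bs)
  case (Suc d)
  let ?zs = "map (\<lambda>y. \<lfloor>of_int k * y\<rfloor>) ys"
  let ?bs = "map2 (refine k) ?zs bs"
  have nI: "of_int k * y \<notin> \<int>" if "y \<in> set ys" for y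
    using Suc.prems(2)[of k y] that by simp
  have box: "list_all2 in_box ys ?bs"
    using Suc.prems(3) nI Suc.prems(6)
    by (auto simp: list_all2_conv_all_nth intro!: in_box_refine)
  have "alive P S d (k + 1) ?bs"
    by (rule Suc.IH) (use Suc.prems box in auto)
  moreover have "feasible S ?bs"
    using feasibleI[OF box] Suc.prems by blast
  moreover have "list_all2 (\<lambda>z xs. z \<in> set xs) ?zs (map (cells k) bs)"
    using Suc.prems(3) by (auto simp: list_all2_conv_all_nth intro!: floor_in_cells Suc.prems)
  moreover have "P k ?zs" using Suc.prems(1)[of k] by simp
  ultimately show ?case
    unfolding alive.simps ex_cells_iff Let_def by blast
qed simp

text \<open>The floors of \<open>k * l\<close>, where \<open>l\<close> is the increasing list of barycentric coordinates of the interior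
  point.\<close>

definition pattern_single :: "int \<Rightarrow> int list \<Rightarrow> bool" where
  "pattern_single k zs \<longleftrightarrow> sum_list zs = (if k \<le> 2 then 0 else k - 2) \<and> sorted zs"

text \<open>The floors \<open>zs\<close> of \<open>k * h * g\<close>, where \<open>k * g\<close> is not a multiple of \<open>l = us / h\<close>: then the fractional
  parts of \<open>k * g + j * l\<close> sum to 2 for every \<open>j\<close>. The bounds on \<open>s\<close> are a cheap consequence,
  tested first.\<close>

definition pattern_coset :: "int list \<Rightarrow> int \<Rightarrow> int \<Rightarrow> int list \<Rightarrow> bool" where
  "pattern_coset us h k zs \<longleftrightarrow>
     hd zs = 0 \<and> (let s = 2 * h * k - sum_list zs in 1 \<le> s \<and> s \<le> 3) \<and>
     list_all (\<lambda>j. sum_list (map2 (\<lambda>z u. (z + j * u) div h) zs us) = 2 * k + j - 2) [0..h - 1]"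

abbreviation coset_box :: "int \<Rightarrow> box list" where
  "coset_box h \<equiv> ((0, 1), (1, 1)) # replicate 3 ((0, 1), (h, 1))"

text \<open>Increasing numerators of \<open>l\<close> over their sums, which are 4, 5, 7, 11, 13, 17
  and 19.\<close>

definition weights :: "int list set" where
  "weights = {[1,1,1,1], [1,1,1,2], [1,1,2,3], [1,2,3,5], [1,3,4,5], [2,3,5,7], [3,4,5,7]}"

text \<open>Numerators over 20; the only case in which the interior point does not generate the group.\<close>

definition exceptional :: "int list set" where
  "exceptional = {[1,9,13,17], [1,9,17,13], [1,13,9,17], [1,13,17,9], [1,17,9,13], [1,17,13,9]}"

text \<open>Runs over the candidates [1, a, b, c] / (h m) for a generator g with m g congruent to us
  / h. A candidate with coordinate sum 2 must be exceptional or violate the floor condition at some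
  k. The values m and h m - m of k are exempt, since there k g is congruent to \<open>l\<close> or
  to its negative. Coordinate 0 contributes no floor, as k < h m.\<close>

definition pattern_small :: "int list \<Rightarrow> int \<Rightarrow> int \<Rightarrow> bool" where
  "pattern_small us h m \<longleftrightarrow> list_all (\<lambda>a. list_all (\<lambda>b. list_all (\<lambda>c.
       1 + a + b + c \<noteq> 2 * h * m \<or> [1, a, b, c] \<in> exceptional \<or>
       list_ex (\<lambda>k. k \<noteq> m \<and> k \<noteq> h * m - m \<and>
         sum_list (map (\<lambda>x. k * x div (h * m)) [a, b, c]) \<noteq> 2 * k - 2) [1..h * m - 1])
     (map (\<lambda>t. us ! 3 + h * t) [0..m - 1]))
     (map (\<lambda>t. us ! 2 + h * t) [0..m - 1]))
     (map (\<lambda>t. us ! 1 + h * t) [0..m - 1])"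

section \<open>Finite checks by evaluation\<close>

lemma not_alive_single: "\<not> alive pattern_single 1 18 1 (replicate 4 ((0, 1), (1, 1)))"
  by code_simp

text \<open>The ranges come from the order of the entries: with sum h and a \<le> b \<le> c \<le> d,
  one has 4 a \<le> h, 3 b \<le> h and 2 c \<le> h. The first disjunct discards the candidates with
  c > d.\<close>

lemma weights_small:
  "list_all (\<lambda>h. list_all (\<lambda>a. list_all (\<lambda>b. list_all (\<lambda>c.
       c > h - a - b - c \<or> [a, b, c, h - a - b - c] \<in> weights \<or>
       list_ex (\<lambda>k. sum_list (map (\<lambda>u. k * u div h) [a, b, c, h - a - b - c]) \<noteq> k - 2) [2..h - 2])
     [b..h div 2]) [a..h div 3]) [1..h div 4]) [4..19]"
  by code_simp

text \<open>These are exactly the indices m > 1 that the depths in \<open>not_alive_coset\<close>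
  leave open.\<close>

lemma pattern_small_numerals:
  "pattern_small [1,1,1,1] 4 2" "pattern_small [1,1,1,1] 4 3" "pattern_small [1,1,1,1] 4 4"
  "pattern_small [1,1,1,1] 4 5" "pattern_small [1,1,1,2] 5 2" "pattern_small [1,1,1,2] 5 3"
  "pattern_small [1,1,2,3] 7 2"
  by code_simp+

text \<open>The coset condition holds for 1 \<le> k < m, so failure at depth D forces m \<le> D.
  Depth 1 means that \<open>l\<close> already generates the group.\<close>

lemma not_alive_coset:
  "\<not> alive (pattern_coset [1,1,1,1] 4) 8 5 1 (coset_box 4)"
  "\<not> alive (pattern_coset [1,1,1,2] 5) 10 3 1 (coset_box 5)"
  "\<not> alive (pattern_coset [1,1,2,3] 7) 14 2 1 (coset_box 7)"
  "\<not> alive (pattern_coset [1,2,3,5] 11) 22 1 1 (coset_box 11)"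
  "\<not> alive (pattern_coset [1,3,4,5] 13) 26 1 1 (coset_box 13)"
  "\<not> alive (pattern_coset [2,3,5,7] 17) 34 1 1 (coset_box 17)"
  "\<not> alive (pattern_coset [3,4,5,7] 19) 38 1 1 (coset_box 19)"
  by code_simp+

subsection \<open>The group of coefficient vectors\<close>

text \<open>Coprimality makes the order of coordinate 0 of \<open>l\<close> modulo 1 exactly h; it
  yields both the divisibility of the group order by h and the Bezout step in
  \<open>generator_cases\<close>.\<close>

lemma weights_facts:
  assumes "us \<in> weights"
  shows "length us = 4" "0 < sum_list us" "coprime (us ! 0) (sum_list us)"
  using assms unfolding weights_def by (auto simp: coprime_iff_gcd_eq_1 gcd_non_0_int)

lemma sum4: "(\<Sum>i<(4::nat). f i) = f 0 + f 1 + f 2 + f 3"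
  by (simp add: eval_nat_numeral add.assoc)

text \<open>\<open>G\<close> will consist of the coefficient vectors, with integer sum, of the lattice points with
  respect to the vertices, and \<open>l\<close> of the barycentric coordinates of the interior point. By
  \<open>unique\<close>, the only other lattice points in the tetrahedron are its vertices.\<close>

locale one_point_group =
  fixes G :: "(nat \<Rightarrow> real) set" and l :: "nat \<Rightarrow> real"
  assumes diff: "f \<in> G \<Longrightarrow> g \<in> G \<Longrightarrow> (\<lambda>i. f i - g i) \<in> G"
    and integral: "(\<And>i. i < 4 \<Longrightarrow> g i \<in> \<int>) \<Longrightarrow> g \<in> G"
    and sum_Ints: "g \<in> G \<Longrightarrow> (\<Sum>i<4. g i) \<in> \<int>"
    and discrete: "\<exists>N>0. \<forall>g\<in>G. \<forall>i<4. of_nat N * g i \<in> \<int>"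
    and l_in: "l \<in> G" and l_pos: "i < 4 \<Longrightarrow> 0 < l i" and l_sum: "(\<Sum>i<4. l i) = 1"
    and l_mono: "i \<le> j \<Longrightarrow> j < 4 \<Longrightarrow> l i \<le> l j"
    and unique: "g \<in> G \<Longrightarrow> (\<And>i. i < 4 \<Longrightarrow> 0 \<le> g i \<and> g i < 1) \<Longrightarrow> (\<Sum>i<4. g i) = 1 \<Longrightarrow>
      i < 4 \<Longrightarrow> g i = l i"
begin

lemma uminus_in: "g \<in> G \<Longrightarrow> (\<lambda>i. - g i) \<in> G"
  using diff[of "\<lambda>i. 0" g] integral[of "\<lambda>i. 0"] by simp

lemma add_in: "f \<in> G \<Longrightarrow> g \<in> G \<Longrightarrow> (\<lambda>i. f i + g i) \<in> G"
  using diff[of f "\<lambda>i. - g i"] uminus_in[of g] by simp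

lemma scale_in:
  assumes "g \<in> G" shows "(\<lambda>i. of_int k * g i) \<in> G"
proof (induction k rule: int_induct[where k = 0])
  case base then show ?case using integral[of "\<lambda>i. 0"] by simp
next
  case (step1 i) then show ?case using add_in[OF step1(2) assms] by (simp add: algebra_simps)
next
  case (step2 i) then show ?case using diff[OF step2(2) assms] by (simp add: algebra_simps)
qed

lemma frac_in: "g \<in> G \<Longrightarrow> (\<lambda>i. frac (g i)) \<in> G"
  using diff[of g "\<lambda>i. of_int \<lfloor>g i\<rfloor>"] integral[of "\<lambda>i. of_int \<lfloor>g i\<rfloor>"] by (simp add: frac_def)

lemma cong_in:
  assumes "f \<in> G" "\<And>i. i < 4 \<Longrightarrow> g i - f i \<in> \<int>" shows "g \<in> G"
  using add_in[OF assms(1), of "\<lambda>i. g i - f i"] integral assms(2) by simp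

lemma l_less_1: "i < 4 \<Longrightarrow> l i < 1"
proof -
  assume "i < 4"
  then have "i = 0 \<or> i = 1 \<or> i = 2 \<or> i = 3" by auto
  then show ?thesis using l_sum l_pos[of 0] l_pos[of 1] l_pos[of 2] l_pos[of 3] by (auto simp: sum4)
qed

lemma frac_sum_eq_1:
  assumes "g \<in> G" "(\<Sum>i<4. frac (g i)) = 1" "i < 4"
  shows "g i - l i \<in> \<int>"
proof -
  have "frac (g i) = l i"
    using unique[OF frac_in[OF assms(1)]] assms frac_ge_0 frac_lt_1 by blast
  then show ?thesis by (simp add: frac_def) (metis Ints_of_int add_diff_cancel_left' diff_add_cancel diff_diff_eq2 )
qed

text \<open>The fractional parts of \<open>g\<close> and of \<open>- g\<close> have sums adding up to the number of non-integral
  coordinates. If that is at most 3, one of the sums is 1, and \<open>unique\<close> applies.\<close>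

lemma Ints_all:
  assumes "g \<in> G" "i < 4" "g i \<in> \<int>" "j < 4"
  shows "g j \<in> \<int>"
proof (rule ccontr)
  assume j: "g j \<notin> \<int>"
  let ?s = "\<lambda>g. \<Sum>i<4. frac (g i :: real)"
  have neg: "(\<lambda>i. - g i) \<in> G" using uminus_in assms(1) .
  have ni: "\<not> l i \<in> \<int>" using l_pos[OF assms(2)] l_less_1[OF assms(2)]
    by (metis Ints_cases of_int_0_less_iff of_int_less_1_iff int_one_le_iff_zero_less not_less)
  have "?s g + ?s (\<lambda>i. - g i) = (\<Sum>i<4. if g i \<in> \<int> then 0 else 1)"
    by (simp add: sum.distrib[symmetric] frac_neg) (intro sum.cong; auto)
  also have "\<dots> \<le> (\<Sum>k<4. if k = i then 0 else 1)"
    using assms(3) by (intro sum_mono) auto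
  also have "\<dots> = 3" using assms(2) by (auto simp: sum4)
  finally have le: "?s g + ?s (\<lambda>i. - g i) \<le> 3" .
  have pos: "0 < ?s f" if "f j \<notin> \<int>" for f
  proof -
    have "0 < frac (f j)" using that by simp
    also have "\<dots> \<le> ?s f" using assms(4) by (intro member_le_sum) auto
    finally show ?thesis .
  qed
  have "0 < ?s g" "0 < ?s (\<lambda>i. - g i)" using pos[of g] pos[of "\<lambda>i. - g i"] j by auto
  moreover have "?s g \<in> \<int>" "?s (\<lambda>i. - g i) \<in> \<int>"
    using sum_Ints[OF frac_in[OF assms(1)]] sum_Ints[OF frac_in[OF neg]] .
  ultimately have "?s g = 1 \<or> ?s (\<lambda>i. - g i) = 1" using le by (auto elim!: Ints_cases)
  \<comment> \<open>Either case makes \<open>g i\<close> congruent to \<open>l i\<close> or to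
    \<open>- l i\<close> modulo 1, so \<open>l i\<close> would be an integer although 0 <
    \<open>l i\<close> < 1.\<close>
  then show False
  proof
    assume "?s g = 1"
    from frac_sum_eq_1[OF assms(1) this assms(2)] show False
      using assms(3) ni Ints_diff by fastforce
  next
    assume "?s (\<lambda>i. - g i) = 1"
    from frac_sum_eq_1[OF neg this assms(2)] show False
      using assms(3) ni by (metis Ints_diff Ints_minus diff_add_cancel diff_diff_eq2 minus_diff_eq uminus_add_conv_diff)
  qed
qed

text \<open>No coordinate is integral, so the fractional parts of \<open>g\<close> and of
  \<open>- g\<close> have positive integer sums with total 4. Neither sum is 1, because
  \<open>g\<close> is not congruent to \<open>l\<close> or its negative; hence both are 2.\<close>

lemma floor_sum_eq:
  assumes "g \<in> G" "i < 4" "g i \<notin> \<int>" "g i - l i \<notin> \<int>" "g i + l i \<notin> \<int>"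
  shows "(\<Sum>i<4. of_int \<lfloor>g i\<rfloor>) = (\<Sum>i<4. g i) - 2"
proof -
  let ?s = "\<lambda>g. \<Sum>i<4. frac (g i :: real)"
  have neg: "(\<lambda>i. - g i) \<in> G" using uminus_in assms(1) .
  have nI: "g j \<notin> \<int>" if "j < 4" for j using Ints_all[OF assms(1) that] assms by blast
  have "?s g + ?s (\<lambda>i. - g i) = (\<Sum>i<(4::nat). 1)"
    by (simp add: sum.distrib[symmetric] frac_neg nI del: sum_constant)
  then have 4: "?s g + ?s (\<lambda>i. - g i) = 4" by simp
  have pos: "0 < ?s g" "0 < ?s (\<lambda>i. - g i)" using nI by (auto intro!: sum_pos simp: lessThan_empty_iff)
  have I: "?s g \<in> \<int>" "?s (\<lambda>i. - g i) \<in> \<int>"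
    using sum_Ints[OF frac_in[OF assms(1)]] sum_Ints[OF frac_in[OF neg]] .
  have "?s g \<noteq> 1" using frac_sum_eq_1[OF assms(1) _ assms(2)] assms(4) by blast
  moreover have "?s (\<lambda>i. - g i) \<noteq> 1"
    using frac_sum_eq_1[OF neg _ assms(2)] assms(5)
    by (metis Ints_minus minus_diff_eq diff_minus_eq_add add.commute)
  ultimately have "?s g = 2" using 4 pos I by (auto elim!: Ints_cases)
  then show ?thesis by (simp add: frac_def sum_subtractf)
qed

section \<open>The possible interior points\<close>

lemma weights_cases:
  obtains us h where "us \<in> weights" "h = sum_list us" "\<And>i. i < 4 \<Longrightarrow> l i = of_int (us ! i) / of_int h"
proof -
  \<comment> \<open>By \<open>Ints_all\<close>, the order of coordinate 0 modulo 1 is the order of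
    the whole vector \<open>l\<close>.\<close>
  define h where "h = (LEAST h::nat. 0 < h \<and> of_nat h * l 0 \<in> \<int>)"
  have "\<exists>h::nat. 0 < h \<and> of_nat h * l 0 \<in> \<int>" using discrete l_in by force
  then have h: "0 < h" "of_nat h * l 0 \<in> \<int>" unfolding h_def by (metis (mono_tags, lifting) LeastI_ex)+
  have min: "h \<le> k" if "0 < k" "of_nat k * l 0 \<in> \<int>" for k
    unfolding h_def using that by (intro Least_le) auto
  have scaled: "(\<lambda>i. of_int k * l i) \<in> G" for k using scale_in l_in by blast
  have nI: "of_int k * l i \<notin> \<int>" if "0 < k" "k < int h" "i < 4" for k i
    using Ints_all[OF scaled that(3), of k 0] min[of "nat k"] that by auto
  define u where "u i = \<lfloor>of_nat h * l i\<rfloor>" for i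
  have l_eq: "l i = of_int (u i) / of_int h" if "i < 4" for i
  proof -
    have "of_int h * l i \<in> \<int>" using Ints_all[OF scaled _ _ that, of 0 h] h by simp
    then show ?thesis using h unfolding u_def by (auto elim!: Ints_cases simp: field_simps)
  qed
  have u_pos: "0 < u i" if "i < 4" for i
    using l_eq[OF that] l_pos[OF that] h by (simp add: zero_less_divide_iff)
  have u_mono: "u i \<le> u j" if "i \<le> j" "j < 4" for i j
    unfolding u_def using l_mono[OF that] by (intro floor_mono mult_left_mono) auto
  have "(u 0 + u 1 + u 2 + u 3) / of_int h = (1::real)"
    using l_sum l_eq[of 0] l_eq[of 1] l_eq[of 2] l_eq[of 3] by (simp add: sum4 add_divide_distrib)
  then have u_sum: "u 0 + u 1 + u 2 + u 3 = h" using h by (simp add: field_simps)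
  have floors: "(\<Sum>i<4. \<lfloor>of_int k * l i\<rfloor>) = k - 2" if "2 \<le> k" "k \<le> int h - 2" for k
  proof -
    \<comment> \<open>These say that k l, k l - l and k l + l are not integral; the bounds on k
      place all three multipliers strictly between 0 and h.\<close>
    have "of_int (k - 1) * l 0 \<notin> \<int>" "of_int k * l 0 \<notin> \<int>" "of_int (k + 1) * l 0 \<notin> \<int>"
      using that by (intro nI; simp)+
    then have "(\<Sum>i<4. of_int \<lfloor>of_int k * l i\<rfloor>) = (\<Sum>i<4. of_int k * l i) - 2"
      by (intro floor_sum_eq[OF scaled, of 0]) (auto simp: algebra_simps)
    also have "\<dots> = of_int (k - 2)" using l_sum by (simp flip: sum_distrib_left)
    finally show ?thesis unfolding of_int_sum[symmetric] of_int_eq_iff .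
  qed
  have h19: "h \<le> 19"
  proof (rule ccontr)
    assume "\<not> h \<le> 19"
    then have big: "20 \<le> h" by simp
    \<comment> \<open>For h \<ge> 20 the floor condition is available up to k = 18 \<le> h - 2,
      which fixes the depth of the search.\<close>
    have "alive pattern_single 1 18 1 (replicate 4 ((0,1),(1,1)))"
    proof (rule aliveI[where ys = "[l 0, l 1, l 2, l 3]"])
      fix k :: int assume k: "1 \<le> k" "k < 1 + int 18"
      show "of_int k * y \<notin> \<int>" if "y \<in> set [l 0, l 1, l 2, l 3]" for y
        using that nI[of k 0] nI[of k 1] nI[of k 2] nI[of k 3] k big by auto
      \<comment> \<open>At k = 1 the formula k - 2 fails: the vector is \<open>l\<close> itself and
        all floors are 0.\<close>
      have "(\<Sum>i<4. \<lfloor>of_int k * l i\<rfloor>) = (if k \<le> 2 then 0 else k - 2)"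
      proof (cases "k = 1")
        case True
        then show ?thesis using l_pos l_less_1 by (auto simp: floor_eq_iff less_imp_le intro!: sum.neutral)
      qed (use floors[of k] k big in auto)
      moreover have "\<lfloor>of_int k * l i\<rfloor> \<le> \<lfloor>of_int k * l j\<rfloor>" if "i \<le> j" "j < 4" for i j
        using l_mono[OF that] k by (intro floor_mono mult_left_mono) auto
      ultimately show "pattern_single k (map (\<lambda>y. \<lfloor>of_int k * y\<rfloor>) [l 0, l 1, l 2, l 3])"
        by (simp add: pattern_single_def eval_nat_numeral)
    next
      show "list_all2 in_box [l 0, l 1, l 2, l 3] (replicate 4 ((0, 1), 1, 1))"
        using l_pos l_less_1 by (simp add: eval_nat_numeral)
      show "sum_list [l 0, l 1, l 2, l 3] = of_int 1" using l_sum by (simp add: sum4)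
    qed auto
    with not_alive_single show False by blast
  qed
  have h4: "4 \<le> h" using u_sum u_pos[of 0] u_pos[of 1] u_pos[of 2] u_pos[of 3] by simp
  note m = u_mono[of 0 1] u_mono[of 1 2] u_mono[of 2 3]
  have u3: "int h - u 0 - u 1 - u 2 = u 3" using u_sum by simp
  have "int h \<in> set [4..19]" "u 0 \<in> set [1..int h div 4]" "u 1 \<in> set [u 0..int h div 3]" "u 2 \<in> set [u 1..int h div 2]"
    unfolding set_upto atLeastAtMost_iff using h19 h4 m u_sum u_pos[of 0] by presburger+
  then have "u 2 > u 3 \<or> [u 0, u 1, u 2, u 3] \<in> weights \<or>
     list_ex (\<lambda>k. sum_list (map (\<lambda>u. k * u div h) [u 0, u 1, u 2, u 3]) \<noteq> k - 2) [2..int h-2]"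
    using weights_small unfolding list_all_iff u3[symmetric] by blast
  moreover have "k * u i div h = \<lfloor>of_int k * l i\<rfloor>" if "i < 4" for i k
    using l_eq[OF that] floor_divide_of_int_eq[of "k * u i" "int h", where ?'a = real] by simp
  then have "sum_list (map (\<lambda>u. k * u div h) [u 0, u 1, u 2, u 3]) = k - 2" if "2 \<le> k" "k \<le> int h - 2" for k
    using floors[OF that] by (simp add: eval_nat_numeral)
  ultimately have w: "[u 0, u 1, u 2, u 3] \<in> weights" using m unfolding list_ex_iff by auto
  show ?thesis
  proof (rule that[OF w])
    show "int h = sum_list [u 0, u 1, u 2, u 3]" using u_sum by simp
    show "l i = of_int ([u 0, u 1, u 2, u 3] ! i) / of_int (int h)" if "i < 4" for i
      using l_eq[OF that] that by (auto simp: eval_nat_numeral less_Suc_eq)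
  qed
qed

text \<open>As a coordinate determines an element up to integers, the smallest positive value of the
  coordinate 0 yields a generator.\<close>

lemma generator:
  obtains g :: "nat \<Rightarrow> real" and n :: nat where "g \<in> G" "0 < n" "g 0 = 1 / n" "\<forall>i<4. 0 \<le> g i \<and> g i < 1"
    "\<forall>f\<in>G. \<exists>t::int. \<forall>i<4. f i - t * g i \<in> \<int>"
proof -
  from discrete obtain N :: nat where N: "0 < N" and NG: "\<forall>g\<in>G. \<forall>i<4. of_nat N * g i \<in> \<int>"
    by (elim exE conjE)
  have coord: "\<exists>q::int. f 0 = q / N" if "f \<in> G" for f
    using bspec[OF NG that, THEN spec, of 0] N by (auto elim!: Ints_cases simp: field_simps)
  define p where "p = (LEAST p::nat. 0 < p \<and> (\<exists>f\<in>G. f 0 = p / N))"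
  have "\<exists>p::nat. 0 < p \<and> (\<exists>f\<in>G. f 0 = p / N)"
  proof -
    obtain q :: int where q: "l 0 = q / N" using coord l_in by blast
    then have "0 < q" using l_pos[of 0] N by (simp add: zero_less_divide_iff)
    then show ?thesis using q l_in by (intro exI[of _ "nat q"]) auto
  qed
  then have "0 < p \<and> (\<exists>f\<in>G. f 0 = p / N)" unfolding p_def by (rule LeastI_ex)
  then obtain f where f: "f \<in> G" "f 0 = p / N" and p: "0 < p" by blast
  have min: "p \<le> k" if "0 < k" "f' \<in> G" "f' 0 = k / N" for k :: nat and f'
    unfolding p_def using that by (intro Least_le) blast
  have mult: "\<exists>t::int. f' 0 = t * f 0 \<and> (\<forall>i<4. f' i - t * f i \<in> \<int>)" if f': "f' \<in> G" for f'
  proof -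
    obtain q :: int where q: "f' 0 = q / N" using coord[OF f'] by blast
    \<comment> \<open>Division with remainder: coordinate 0 of \<open>?r\<close> is a nonnegative
      multiple of 1 / N below \<open>f 0\<close>, so it vanishes by minimality.\<close>
    let ?r = "\<lambda>i. f' i - (q div p) * f i"
    have r: "?r \<in> G" using diff[OF f' scale_in[OF f(1), of "q div p"]] by simp
    have "q - (q div p) * p = q mod p" by (metis minus_div_mult_eq_mod)
    then have "of_int q - of_int (q div p) * of_int p = (of_int (q mod p) :: real)"
      by (metis of_int_diff of_int_mult)
    then have r0: "?r 0 = (q mod p) / N" using q f(2) N by (simp add: field_simps)
    have "q mod p = 0"
    proof (rule ccontr)
      assume "q mod p \<noteq> 0"
      moreover have "0 \<le> q mod p" "q mod p < p" using p by simp_all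
      ultimately have pos: "0 < q mod p" "q mod p < p" by linarith+
      then have "p \<le> nat (q mod p)"
        using r r0 by (intro min[of _ ?r]) simp_all
      with pos show False by simp
    qed
    then have "?r 0 = 0" using r0 by simp
    moreover have "?r i \<in> \<int>" if "i < 4" for i using Ints_all[OF r, of 0 i] \<open>?r 0 = 0\<close> that by simp
    ultimately show ?thesis by auto
  qed
  \<comment> \<open>The constant vector 1 lies in the group, so 1 is an integer multiple of
    \<open>f 0\<close>.\<close>
  obtain t :: int where t: "1 = t * f 0" using mult[of "\<lambda>i. 1"] integral[of "\<lambda>i. 1"] by auto
  have f0: "0 < f 0" using f p N by simp
  then have "0 < t" using t by (metis of_int_0_less_iff zero_less_mult_pos2 zero_less_one)
  have f0t: "f 0 = 1 / t" using t \<open>0 < t\<close> by (simp add: field_simps)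
  \<comment> \<open>Needed for \<open>frac (f 0) = f 0\<close>: the fractional part of 1 would be
    0.\<close>
  have "t \<noteq> 1"
  proof
    assume "t = 1"
    then have "f 0 = 1" using f0t by simp
    from mult[OF l_in] this obtain s :: int where "l 0 = s" by auto
    with l_pos[of 0] l_less_1[of 0] show False by simp
  qed
  then have "2 \<le> t" using \<open>0 < t\<close> by simp
  show ?thesis
  proof (rule that[of "\<lambda>i. frac (f i)" "nat t"])
    show "(\<lambda>i. frac (f i)) \<in> G" using frac_in f by blast
    show "frac (f 0) = 1 / nat t" using f0t \<open>2 \<le> t\<close> by (simp add: frac_eq)
    show "\<forall>f'\<in>G. \<exists>t::int. \<forall>i<4. f' i - t * frac (f i) \<in> \<int>"
    proof
      fix f' assume "f' \<in> G"
      then obtain s :: int where s: "\<forall>i<4. f' i - s * f i \<in> \<int>" using mult by blast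
      have "f' i - s * frac (f i) \<in> \<int>" if "i < 4" for i
      proof -
        have "f' i - s * frac (f i) = (f' i - s * f i) + of_int (s * \<lfloor>f i\<rfloor>)"
          by (simp add: frac_def algebra_simps)
        then show ?thesis using s that by (metis Ints_add Ints_of_int)
      qed
      then show "\<exists>t::int. \<forall>i<4. f' i - t * frac (f i) \<in> \<int>" by blast
    qed
  qed (use \<open>0 < t\<close> frac_lt_1 in auto)
qed

text \<open>This will be applied to a generator \<open>g\<close>; then \<open>l\<close> generates a subgroup of index \<open>m\<close>.\<close>

context
  fixes us :: "int list" and h :: int and g :: "nat \<Rightarrow> real" and m :: int
  assumes len: "length us = 4" and h_pos: "0 < h"
    and l_eq: "\<And>i. i < 4 \<Longrightarrow> l i = of_int (us ! i) / of_int h"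
    and g_in: "g \<in> G" and g_0: "g 0 = 1 / of_int (h * m)"
    and g_bounds: "\<And>i. i < 4 \<Longrightarrow> 0 \<le> g i \<and> g i < 1"
    and m: "1 < m"
begin

section \<open>The index of the subgroup generated by \<open>l\<close>\<close>

lemma combination_in: "(\<lambda>i. of_int k * g i + of_int j * l i) \<in> G"
  using add_in[OF scale_in[OF g_in] scale_in[OF l_in]] .

lemma of_int_div_not_Ints:
  assumes "0 < n" "\<not> n dvd k" shows "of_int k / of_int n \<notin> (\<int> :: real set)"
proof
  assume "of_int k / of_int n \<in> (\<int> :: real set)"
  then obtain z :: int where "of_int k / of_int n = (of_int z :: real)" by (elim Ints_cases)
  then have "real_of_int k = of_int (z * n)" using assms(1) by (simp add: field_simps)
  then have "k = z * n" unfolding of_int_eq_iff .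
  with assms(2) show False by simp
qed

text \<open>Over the denominator h m, the numerator is congruent to k modulo m and hence not
  divisible by m.\<close>

lemma coset_not_Ints: "of_int k * g 0 + of_int j * l 0 \<notin> \<int>" if "1 \<le> k" "k < m"
proof -
  have "of_int k * g 0 + of_int j * l 0 = of_int (k + j * us ! 0 * m) / of_int (h * m)"
    using h_pos m by (simp add: l_eq[of 0] g_0 field_simps)
  moreover have "\<not> h * m dvd k + j * us ! 0 * m"
  proof
    assume "h * m dvd k + j * us ! 0 * m"
    then have "m dvd k + j * us ! 0 * m" using dvd_mult_right by blast
    then have "m dvd k" by (metis dvd_add_left_iff dvd_triv_right)
    with that show False using zdvd_imp_le by force
  qed
  moreover have "0 < h * m" using h_pos m by simp
  ultimately show ?thesis by (simp only: of_int_div_not_Ints not_False_eq_True)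
qed

text \<open>Applying \<open>coset_not_Ints\<close> to j, j - 1 and j + 1 gives the three conditions
  of \<open>floor_sum_eq\<close>.\<close>

lemma coset_floor_sum:
  assumes "1 \<le> k" "k < m"
  shows "(\<Sum>i<4. of_int \<lfloor>of_int k * g i + of_int j * l i\<rfloor>) = of_int k * (\<Sum>i<4. g i) + of_int j - 2"
proof -
  have "(\<Sum>i<4. of_int \<lfloor>of_int k * g i + of_int j * l i\<rfloor>) = (\<Sum>i<4. of_int k * g i + of_int j * l i) - 2"
    using coset_not_Ints[OF assms, of j] coset_not_Ints[OF assms, of "j - 1"] coset_not_Ints[OF assms, of "j + 1"]
    by (intro floor_sum_eq[OF combination_in, of 0]) (auto simp: algebra_simps)
  also have "(\<Sum>i<4. of_int k * g i + of_int j * l i) = of_int k * (\<Sum>i<4. g i) + of_int j"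
    using l_sum by (simp add: sum.distrib flip: sum_distrib_left)
  finally show ?thesis by simp
qed

text \<open>The case k = 1, j = 0 of \<open>coset_floor_sum\<close>, where all floors
  vanish.\<close>

lemma g_sum: "(\<Sum>i<4. g i) = 2"
proof -
  have "\<lfloor>g i\<rfloor> = 0" if "i < 4" for i using g_bounds[OF that] by (simp add: floor_eq_iff)
  then show ?thesis using coset_floor_sum[of 1 0] m by simp
qed

lemma g_not_Ints: "of_int k * g i \<notin> \<int>" if "\<not> h * m dvd k" "i < 4"
proof
  assume "of_int k * g i \<in> \<int>"
  then have "of_int k * g 0 \<in> \<int>" using Ints_all[OF scale_in[OF g_in] that(2), of k 0] by simp
  then show False using of_int_div_not_Ints[OF _ that(1)] g_0 h_pos m by simp
qed

lemma g_pos: "i < 4 \<Longrightarrow> 0 < g i"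
  using g_not_Ints[of 1 i] g_bounds[of i] m h_pos
  by (metis Ints_0 dvd_mult_right less_le mult_1 of_int_1 zdvd_not_zless zero_less_one)

text \<open>For m > D the vector h g would survive the search. Scaling by h lets one list of floors
  control k g + j l for every j at once.\<close>

lemma index_le:
  assumes "\<not> alive (pattern_coset us h) (2 * h) D 1 (coset_box h)"
  shows "m \<le> int D"
proof (rule ccontr)
  assume "\<not> m \<le> int D"
  then have D: "int D < m" by simp
  let ?ys = "[of_int h * g 0, of_int h * g 1, of_int h * g 2, of_int h * g 3]"
  have "alive (pattern_coset us h) (2 * h) D 1 (coset_box h)"
  proof (rule aliveI[where ys = ?ys])
    fix k :: int assume k: "1 \<le> k" "k < 1 + int D"
    then have km: "k < m" using D by simp
    have "\<not> m dvd k" using k km zdvd_imp_le by force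
    then have hk: "\<not> h * m dvd k * h" using h_pos by (simp add: mult.commute)
    then have nI: "of_int k * (of_int h * g i) \<notin> \<int>" if "i < 4" for i
      using g_not_Ints[OF hk that] by (simp add: mult.assoc)
    then show "of_int k * y \<notin> \<int>" if "y \<in> set ?ys" for y using that by auto
    define z where "z i = \<lfloor>of_int k * (of_int h * g i)\<rfloor>" for i
    have z_bounds: "of_int (z i) < of_int k * (of_int h * g i)" "of_int k * (of_int h * g i) < of_int (z i) + 1"
      if "i < 4" for i
      using nI[OF that] of_int_floor_le[of "of_int k * (of_int h * g i)"] unfolding z_def
      by (metis Ints_of_int order_le_less, linarith)
    have "of_int k * (of_int h * g 0) + of_int k * (of_int h * g 1) + of_int k * (of_int h * g 2)
        + of_int k * (of_int h * g 3) = of_int (2 * h * k)"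
      using arg_cong[OF g_sum, of "\<lambda>x. of_int k * of_int h * x"] by (simp add: sum4 algebra_simps)
    then have "of_int (z 0 + z 1 + z 2 + z 3) < (of_int (2 * h * k) :: real)"
      "(of_int (2 * h * k) :: real) < of_int (z 0 + z 1 + z 2 + z 3 + 4)"
      using z_bounds[of 0] z_bounds[of 1] z_bounds[of 2] z_bounds[of 3] by linarith+
    \<comment> \<open>The difference is the sum of four fractional parts in the open unit interval,
      hence an integer strictly between 0 and 4.\<close>
    then have sum: "1 \<le> 2 * h * k - (z 0 + z 1 + z 2 + z 3)" "2 * h * k - (z 0 + z 1 + z 2 + z 3) \<le> 3"
      unfolding of_int_less_iff by linarith+
    have "of_int k * (of_int h * g 0) = of_int k / of_int m"
      using g_0 h_pos by simp
    then have z0: "z 0 = 0" using k km by (simp add: z_def floor_eq_iff)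
    \<comment> \<open>The floor of a real divided by a positive integer h depends only on the floor
      of the real.\<close>
    have div: "(z i + j * us ! i) div h = \<lfloor>of_int k * g i + of_int j * l i\<rfloor>" if "i < 4" for i j
    proof -
      have "of_int k * g i + of_int j * l i = (of_int k * (of_int h * g i) + of_int (j * us ! i)) / of_int h"
        using h_pos l_eq[OF that] by (simp add: field_simps)
      then show ?thesis using h_pos floor_divide_real_eq_div[of h "of_int k * (of_int h * g i) + of_int (j * us ! i)"]
        by (simp add: z_def del: of_int_mult)
    qed
    have "(\<Sum>i<4. \<lfloor>of_int k * g i + of_int j * l i\<rfloor>) = 2 * k + j - 2" for j
    proof -
      have "real_of_int (\<Sum>i<4. \<lfloor>of_int k * g i + of_int j * l i\<rfloor>) = real_of_int (2 * k + j - 2)"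
        using coset_floor_sum[OF k(1) km, of j] g_sum by simp
      then show ?thesis unfolding of_int_eq_iff .
    qed
    then have S: "(\<Sum>i<4. (z i + j * us ! i) div h) = 2 * k + j - 2" for j
      using div by simp
    obtain a b c d where us: "us = [a, b, c, d]"
      using len by (auto simp: eval_nat_numeral length_Suc_conv)
    have "(z 0 + j * a) div h + ((z 1 + j * b) div h + ((z 2 + j * c) div h + (z 3 + j * d) div h))
        = 2 * k + j - 2" for j
      using S[of j] by (simp add: us sum4 add.assoc)
    then have "pattern_coset us h k [z 0, z 1, z 2, z 3]"
      using sum unfolding pattern_coset_def us list_all_iff by (simp add: z0 add.assoc)
    then show "pattern_coset us h k (map (\<lambda>y. \<lfloor>of_int k * y\<rfloor>) ?ys)"
      by (simp add: z_def)
  next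
    have "in_box (of_int h * g i) ((0, 1), (h, 1))" if "i < 4" for i
      using g_pos[OF that] g_bounds[OF that] h_pos by simp
    moreover have "in_box (of_int h * g 0) ((0, 1), (1, 1))"
      using g_0 h_pos m by simp
    ultimately show "list_all2 in_box ?ys (coset_box h)" by (simp add: eval_nat_numeral)
    show "sum_list ?ys = of_int (2 * h)"
      using arg_cong[OF g_sum, of "\<lambda>x. of_int h * x"] by (simp add: sum4 algebra_simps)
  qed simp_all
  with assms show False by contradiction
qed

lemma exceptional_case:
  assumes "us ! 0 = 1" "pattern_small us h m"
  obtains as where "as \<in> exceptional" "\<And>i. i < 4 \<Longrightarrow> g i = of_int (as ! i) / 20"
proof -
  let ?n = "h * m"
  have n: "0 < ?n" using h_pos m by simp
  define a where "a i = \<lfloor>of_int ?n * g i\<rfloor>" for i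
  have "of_int ?n * g i \<in> \<int>" if "i < 4" for i
    using Ints_all[OF scale_in[OF g_in], of 0 ?n i] that g_0 h_pos m by simp
  then have g_eq: "g i = of_int (a i) / of_int ?n" if "i < 4" for i
    using that n unfolding a_def by (auto elim!: Ints_cases simp: field_simps)
  have a0: "a 0 = 1" using g_0 h_pos m unfolding a_def by simp
  have a_bounds: "0 < a i" "a i < ?n" if "i < 4" for i
  proof -
    have "0 < of_int ?n * g i" "of_int ?n * g i < of_int ?n * 1"
      using n g_pos[OF that] g_bounds[OF that]
      by (intro mult_pos_pos mult_strict_left_mono; simp only: of_int_0_less_iff)+
    moreover have "of_int ?n * g i = of_int (a i)" using g_eq[OF that] h_pos m by simp
    ultimately show "0 < a i" "a i < ?n" by linarith+
  qed
  have a_cong: "\<exists>t\<in>set [0..m-1]. a i = us ! i + h * t" if "i < 4" for i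
  proof -
    \<comment> \<open>Since \<open>us ! 0 = 1\<close>, m g and \<open>l\<close> agree in coordinate
      0, hence modulo integers in every coordinate.\<close>
    let ?f = "\<lambda>i. of_int m * g i - l i"
    have "?f 0 = 0" using g_0 l_eq[of 0] assms(1) m by simp
    then have "?f i \<in> \<int>"
      using Ints_all[OF diff[OF scale_in[OF g_in] l_in], of 0 m i] that by simp
    then obtain t :: int where t: "of_int m * g i - l i = t" by (auto elim: Ints_cases)
    then have "real_of_int (a i) = of_int (us ! i + h * t)"
      using g_eq[OF that] l_eq[OF that] h_pos m by (simp add: field_simps)
    then have eq: "a i = us ! i + h * t" by linarith
    have u: "0 < us ! i" "us ! i < h"
      using l_pos[OF that] l_less_1[OF that] l_eq[OF that] h_pos by (auto simp: zero_less_divide_iff)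
    have "h * (- 1) < h * t" "h * t < h * m" using eq u a_bounds[OF that] by linarith+
    then have "- 1 < t" "t < m" using h_pos by (simp_all only: mult_less_cancel_left_pos)
    with eq show ?thesis by auto
  qed
  have "(\<Sum>i<4. of_int (a i) / of_int ?n) = (2 :: real)" using g_sum g_eq by simp
  then have "real_of_int (a 0 + a 1 + a 2 + a 3) = of_int (2 * h * m)"
    using h_pos m by (simp add: sum4 field_simps)
  then have a_sum: "1 + a 1 + a 2 + a 3 = 2 * h * m" using a0 by linarith
  have floors: "k * a 1 div ?n + (k * a 2 div ?n + k * a 3 div ?n) = 2 * k - 2"
    if k: "1 \<le> k" "k \<le> ?n - 1" "k \<noteq> m" "k \<noteq> ?n - m" for k
  proof -
    \<comment> \<open>As m g is congruent to \<open>l\<close>, these say that k g is congruent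
      neither to 0 nor to \<open>l\<close> nor to its negative.\<close>
    have dvd: "\<not> ?n dvd k" "\<not> ?n dvd k - m" "\<not> ?n dvd k + m"
    proof -
      have "m < ?n"
        using l_pos[of 0] l_less_1[of 0] l_eq[of 0] assms(1) h_pos m by simp
      show "\<not> ?n dvd k" using k zdvd_imp_le by force
      show "\<not> ?n dvd k - m"
      proof
        assume "?n dvd k - m"
        then have "?n \<le> \<bar>k - m\<bar>" using k(3) n dvd_imp_le_int[of "k - m" ?n] by linarith
        with k m \<open>m < ?n\<close> show False by linarith
      qed
      show "\<not> ?n dvd k + m"
      proof
        assume "?n dvd k + m"
        then have "?n dvd k + m - ?n" by simp
        then have "?n \<le> \<bar>k + m - ?n\<bar>" using k(4) n dvd_imp_le_int[of "k + m - ?n" ?n] by linarith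
        with k m \<open>m < ?n\<close> show False by linarith
      qed
    qed
    have l0: "l 0 = of_int m * g 0" using g_0 l_eq[of 0] assms(1) m by simp
    have "of_int k * g 0 \<notin> \<int>" "of_int (k - m) * g 0 \<notin> \<int>" "of_int (k + m) * g 0 \<notin> \<int>"
      using dvd by (intro g_not_Ints; simp)+
    then have "(\<Sum>i<4. of_int \<lfloor>of_int k * g i\<rfloor>) = (\<Sum>i<4. of_int k * g i) - 2"
      by (intro floor_sum_eq[OF scale_in[OF g_in], of 0]) (auto simp: l0 algebra_simps)
    also have "\<dots> = of_int (2 * k - 2)" using g_sum by (simp flip: sum_distrib_left)
    finally have "(\<Sum>i<4. \<lfloor>of_int k * g i\<rfloor>) = 2 * k - 2"
      unfolding of_int_sum[symmetric] of_int_eq_iff .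
    moreover have "\<lfloor>of_int k * g i\<rfloor> = k * a i div ?n" if "i < 4" for i
      using g_eq[OF that] floor_divide_of_int_eq[of "k * a i" ?n, where ?'a = real] by simp
    moreover have "k * 1 div ?n = 0" using k by simp
    ultimately show ?thesis using a0 by (simp add: eval_nat_numeral)
  qed
  have mem: "a i \<in> set (map (\<lambda>t. us ! i + h * t) [0..m-1])" if "i < 4" for i
    using a_cong[OF that] by auto
  have "1 + a 1 + a 2 + a 3 \<noteq> 2 * h * m \<or> [1, a 1, a 2, a 3] \<in> exceptional \<or>
    list_ex (\<lambda>k. k \<noteq> m \<and> k \<noteq> h * m - m \<and>
      sum_list (map (\<lambda>x. k * x div (h*m)) [a 1, a 2, a 3]) \<noteq> 2 * k - 2) [1..h*m-1]"
    using assms(2) mem[of 1] mem[of 2] mem[of 3] unfolding pattern_small_def list_all_iff by force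
  then have ex: "[1, a 1, a 2, a 3] \<in> exceptional"
    using a_sum floors unfolding list_ex_iff by auto
  \<comment> \<open>The entries of every exceptional vector sum to 40, and this sum is 2 h
    m.\<close>
  then have 20: "h * m = 20" using a_sum unfolding exceptional_def by auto
  show ?thesis
  proof (rule that[OF ex])
    show "g i = of_int ([1, a 1, a 2, a 3] ! i) / 20" if "i < 4" for i
      using g_eq[OF that] 20 a0 that by (auto simp: eval_nat_numeral less_Suc_eq)
  qed
qed

end

lemma generator_cases:
  obtains x where "x \<in> G" "\<And>f. f \<in> G \<Longrightarrow> \<exists>t::int. \<forall>i<4. f i - of_int t * x i \<in> \<int>"
    "(\<exists>us\<in>weights. \<forall>i<4. x i = of_int (us ! i) / of_int (sum_list us)) \<or>
     (\<exists>as\<in>exceptional. \<forall>i<4. x i = of_int (as ! i) / 20)"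
proof -
  obtain us h where us: "us \<in> weights" "h = sum_list us"
    and l_eq: "\<And>i. i < 4 \<Longrightarrow> l i = of_int (us ! i) / of_int h" using weights_cases by blast
  note facts = weights_facts[OF us(1), folded us(2)]
  obtain g :: "nat \<Rightarrow> real" and n :: nat where g: "g \<in> G" "0 < n" "g 0 = 1 / n"
    and bounds: "\<forall>i<4. 0 \<le> g i \<and> g i < 1" and gen: "\<forall>f\<in>G. \<exists>t::int. \<forall>i<4. f i - t * g i \<in> \<int>"
    by (rule generator)
  have g4: "\<And>i. i < 4 \<Longrightarrow> 0 \<le> g i \<and> g i < 1" using bounds by simp
  obtain t :: int where "\<forall>i<4. l i - t * g i \<in> \<int>" using bspec[OF gen l_in] by (elim exE)
  then have "l 0 - t * g 0 \<in> \<int>" by simp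
  then obtain z :: int where z: "l 0 - t * g 0 = z" by (elim Ints_cases)
  \<comment> \<open>Clearing denominators and using coprimality shows that h divides n; the quotient
    m is the index.\<close>
  have "real_of_int (us ! 0 * n) = of_int (h * (t + z * n))"
    using z l_eq[of 0] g(2,3) facts(2) by (simp add: field_simps)
  then have "us ! 0 * n = h * (t + z * n)" unfolding of_int_eq_iff .
  then have "h dvd us ! 0 * int n" by simp
  then have "h dvd int n" using facts(3) by (metis coprime_commute coprime_dvd_mult_right_iff)
  then obtain m where m: "int n = h * m" by blast
  have m_pos: "0 < m" using m g(2) facts(2) by (metis of_nat_0_less_iff zero_less_mult_pos)
  have g_0: "g 0 = 1 / of_int (h * m)" using g(3) m by (metis of_int_of_nat_eq)
  show ?thesis
  proof (cases "m = 1")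
    case True
    show ?thesis
    proof (rule that[of l])
      show "l \<in> G" by (rule l_in)
      show "(\<exists>us\<in>weights. \<forall>i<4. l i = of_int (us ! i) / of_int (sum_list us)) \<or>
        (\<exists>as\<in>exceptional. \<forall>i<4. l i = of_int (as ! i) / 20)"
        using us l_eq by blast
      fix f assume f: "f \<in> G"
      obtain t :: int where "\<forall>i<4. f i - t * g i \<in> \<int>" using bspec[OF gen f] by (elim exE)
      then have "f 0 - t * g 0 \<in> \<int>" by simp
      then obtain z :: int where z: "f 0 - t * g 0 = z" by (elim Ints_cases)
      \<comment> \<open>For index 1, \<open>us ! 0\<close> is invertible modulo h, so coordinate 0
        of any element is matched by a multiple of \<open>l\<close>.\<close>
      obtain p q where pq: "p * us ! 0 + q * h = 1"
        using bezout_int[of "us ! 0" h] facts(3) by auto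
      define j where "j = t * p"
      define y where "y = t * q"
      have y: "t = us ! 0 * j + h * y"
        using arg_cong[OF pq, of "\<lambda>x. t * x"] unfolding j_def y_def by (simp add: algebra_simps)
      let ?f = "\<lambda>i. f i - of_int j * l i"
      have "?f 0 = of_int (z + y)"
        using z True y facts(2) by (simp add: l_eq[of 0] g_0 field_simps)
      then have "?f 0 \<in> \<int>" by (simp only: Ints_of_int)
      then have "?f i \<in> \<int>" if "i < 4" for i
        using Ints_all[OF diff[OF f scale_in[OF l_in]], of 0 j i] that by simp
      then show "\<exists>t::int. \<forall>i<4. f i - of_int t * l i \<in> \<int>" by blast
    qed
  next
    case False
    then have m1: "1 < m" using m_pos by simp
    note le = index_le[OF facts(1,2) l_eq g(1) g_0 g4 m1]
    have small: "us ! 0 = 1 \<and> pattern_small us h m"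
    proof -
      consider "us = [1,1,1,1]" "h = 4" | "us = [1,1,1,2]" "h = 5" | "us = [1,1,2,3]" "h = 7"
        | "us = [1,2,3,5]" "h = 11" | "us = [1,3,4,5]" "h = 13" | "us = [2,3,5,7]" "h = 17"
        | "us = [3,4,5,7]" "h = 19"
        using us unfolding weights_def by auto
      then show ?thesis
      proof cases
        case 1
        then have "m \<le> 5" using le[of 5] not_alive_coset(1) by simp
        then have "m \<in> {2, 3, 4, 5}" using m1 by auto
        then show ?thesis using pattern_small_numerals 1 by auto
      next
        case 2
        then have "m \<le> 3" using le[of 3] not_alive_coset(2) by simp
        then have "m \<in> {2, 3}" using m1 by auto
        then show ?thesis using pattern_small_numerals 2 by auto
      next
        case 3
        then have "m = 2" using le[of 2] not_alive_coset(3) m1 by simp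
        then show ?thesis using pattern_small_numerals 3 by auto
      next
        case 4
        then show ?thesis using le[of 1] not_alive_coset(4) m1 by simp
      next
        case 5
        then show ?thesis using le[of 1] not_alive_coset(5) m1 by simp
      next
        case 6
        then show ?thesis using le[of 1] not_alive_coset(6) m1 by simp
      next
        case 7
        then show ?thesis using le[of 1] not_alive_coset(7) m1 by simp
      qed
    qed
    obtain as where as: "as \<in> exceptional" "\<And>i. i < 4 \<Longrightarrow> g i = of_int (as ! i) / 20"
      using exceptional_case[OF facts(1,2) l_eq g(1) g_0 g4 m1] small by metis
    show ?thesis
    proof (rule that[OF g(1)])
      show "\<exists>t::int. \<forall>i<4. f i - of_int t * g i \<in> \<int>" if "f \<in> G" for f
        using bspec[OF gen that] .
      show "(\<exists>us\<in>weights. \<forall>i<4. g i = of_int (us ! i) / of_int (sum_list us)) \<or>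
        (\<exists>as\<in>exceptional. \<forall>i<4. g i = of_int (as ! i) / 20)"
        using as by blast
    qed
  qed
qed

end

subsection \<open>Lattice tetrahedra\<close>

lemma int_lattice_diff: "x \<in> int_lattice \<Longrightarrow> y \<in> int_lattice \<Longrightarrow> x - y \<in> int_lattice"
  unfolding int_lattice_def by simp

lemma int_lattice_scaleR: "c \<in> \<int> \<Longrightarrow> x \<in> int_lattice \<Longrightarrow> c *\<^sub>R x \<in> int_lattice"
  unfolding int_lattice_def by simp

lemma int_lattice_sum: "(\<And>i. i \<in> I \<Longrightarrow> f i \<in> int_lattice) \<Longrightarrow> sum f I \<in> int_lattice"
  unfolding int_lattice_def by (simp add: Ints_sum)

lemma det_Ints:
  fixes A :: "real^'n^'n"
  assumes "\<And>i j. A $ i $ j \<in> \<int>"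
  shows "det A \<in> \<int>"
  unfolding det_def using assms by (intro Ints_sum Ints_mult Ints_prod) auto

text \<open>Only the values at indices below 4 matter; the others are unconstrained.\<close>

definition bary_lattice :: "(nat \<Rightarrow> real^3) \<Rightarrow> (nat \<Rightarrow> real) set" where
  "bary_lattice v = {g. (\<Sum>i<4. g i) \<in> \<int> \<and> (\<Sum>i<4. g i *\<^sub>R v i) \<in> int_lattice}"

text \<open>The columns are the edges leaving \<open>v 0\<close>; the case distinction translates
  the index type 3 into natural numbers.\<close>

definition edge_matrix :: "(nat \<Rightarrow> real^3) \<Rightarrow> real^3^3" where
  "edge_matrix v = (\<chi> i j. (v (if j = 1 then 1 else if j = 2 then 2 else 3) - v 0) $ i)"

lemma edge_matrix_mult:
  "edge_matrix v *v c = c $ 1 *\<^sub>R (v 1 - v 0) + c $ 2 *\<^sub>R (v 2 - v 0) + c $ 3 *\<^sub>R (v 3 - v 0)"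
  by (simp add: vec_eq_iff matrix_vector_mult_def edge_matrix_def sum_3 algebra_simps)

lemma edge_matrix_mult_axis:
  "edge_matrix v *v axis 1 1 = v 1 - v 0" "edge_matrix v *v axis 2 1 = v 2 - v 0"
  "edge_matrix v *v axis 3 1 = v 3 - v 0"
  by (simp_all add: edge_matrix_mult axis_def)

lemma edge_matrix_mult_bary:
  "edge_matrix v *v vector [g 1, g 2, g 3] = (\<Sum>i<4. g i *\<^sub>R v i) - (\<Sum>i<4. g i) *\<^sub>R v 0"
  by (simp add: edge_matrix_mult sum4 algebra_simps)

lemma det_edge_matrix_neq_0:
  assumes "inj_on v {..<4::nat}" "\<not> affine_dependent (v ` {..<4})"
  shows "det (edge_matrix v) \<noteq> 0"
proof -
  have "c = 0" if "edge_matrix v *v c = 0" for c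
  proof -
    \<comment> \<open>A kernel vector becomes an affine dependence once \<open>v 0\<close> receives
      the coefficient that makes the sum 0.\<close>
    define g where "g i = (if i = 0 then - (c $ 1 + c $ 2 + c $ 3) else if i = 1 then c $ 1
      else if i = 2 then c $ 2 else c $ 3)" for i :: nat
    define U where "U x = g (inv_into {..<4} v x)" for x
    have U: "U (v i) = g i" if "i < 4" for i
      unfolding U_def using inv_into_f_f[OF assms(1), of i] that by simp
    have "sum U (v ` {..<4}) = (\<Sum>i<4. g i)"
      using sum.reindex[OF assms(1), of U] U by simp
    then have "sum U (v ` {..<4}) = 0" by (simp add: sum4 g_def)
    moreover have "(\<Sum>x\<in>v ` {..<4}. U x *\<^sub>R x) = (\<Sum>i<4. g i *\<^sub>R v i)"
      using sum.reindex[OF assms(1), of "\<lambda>x. U x *\<^sub>R x"] U by simp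
    then have "(\<Sum>x\<in>v ` {..<4}. U x *\<^sub>R x) = 0"
      using that by (simp add: edge_matrix_mult sum4 g_def algebra_simps)
    ultimately have "\<forall>x\<in>v ` {..<4}. U x = 0"
      using assms(2) by (subst (asm) affine_dependent_explicit_finite) auto
    then have "g i = 0" if "i < 4" for i using U that by force
    from this[of 1] this[of 2] this[of 3] show "c = 0"
      by (simp add: g_def vec_eq_iff forall_3)
  qed
  then have "invertible (edge_matrix v)"
    unfolding invertible_left_inverse matrix_left_invertible_ker by blast
  then show ?thesis by (simp add: invertible_det_nz)
qed

lemma bary_unique:
  assumes "det (edge_matrix v) \<noteq> 0" "(\<Sum>i<4. f i) = (\<Sum>i<4. g i)"
    "(\<Sum>i<4. f i *\<^sub>R v i) = (\<Sum>i<4. g i *\<^sub>R v i)" "i < 4"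
  shows "f i = g i"
proof -
  have "edge_matrix v *v vector [f 1, f 2, f 3] = edge_matrix v *v vector [g 1, g 2, g 3]"
    unfolding edge_matrix_mult_bary assms(2,3) ..
  then have "(vector [f 1, f 2, f 3] :: real^3) = vector [g 1, g 2, g 3]"
    using assms(1) inj_matrix_vector_mult[of "edge_matrix v"] invertible_det_nz[of "edge_matrix v"]
    by (auto dest: injD)
  then have "f 1 = g 1 \<and> f 2 = g 2 \<and> f 3 = g 3" by (simp add: vec_eq_iff forall_3)
  moreover have "f 0 = g 0" using calculation assms(2) by (simp add: sum4)
  moreover have "i = 0 \<or> i = 1 \<or> i = 2 \<or> i = 3" using assms(4) by auto
  ultimately show ?thesis by auto
qed

lemma edge_matrix_Ints:
  assumes "\<And>i. i < 4 \<Longrightarrow> v i \<in> int_lattice"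
  shows "edge_matrix v $ i $ j \<in> \<int>"
  using assms[of 0] assms[of 1] assms[of 2] assms[of 3] by (simp add: edge_matrix_def int_lattice_def)

text \<open>By Cramer's rule the products for i = 1, 2, 3 are determinants of integer matrices; i =
  0 follows from the integral coefficient sum. This bounds the denominators in the group.\<close>

lemma det_mult_bary_Ints:
  assumes v: "\<And>i. i < 4 \<Longrightarrow> v i \<in> int_lattice" and g: "g \<in> bary_lattice v" and i: "i < 4"
  shows "det (edge_matrix v) * g i \<in> \<int>"
proof -
  let ?A = "edge_matrix v" and ?c = "vector [g 1, g 2, g 3] :: real^3"
  have "?A *v ?c \<in> int_lattice"
    using g v[of 0] unfolding edge_matrix_mult_bary bary_lattice_def
    by (auto intro: int_lattice_diff int_lattice_scaleR)
  then have "?c $ k * det ?A \<in> \<int>" for k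
    unfolding cramer_lemma[symmetric] using edge_matrix_Ints[OF v]
    by (intro det_Ints) (simp add: int_lattice_def)
  from this[of 1] this[of 2] this[of 3]
  have *: "det ?A * g 1 \<in> \<int>" "det ?A * g 2 \<in> \<int>" "det ?A * g 3 \<in> \<int>" by (simp_all add: mult.commute)
  have "det ?A * (\<Sum>i<4. g i) \<in> \<int>"
    using g det_Ints[of ?A] edge_matrix_Ints[OF v] unfolding bary_lattice_def by (intro Ints_mult) auto
  then have "det ?A * (\<Sum>i<4. g i) - det ?A * g 1 - det ?A * g 2 - det ?A * g 3 \<in> \<int>"
    using * by (intro Ints_diff)
  then have "det ?A * g 0 \<in> \<int>" by (simp add: sum4 algebra_simps)
  moreover have "i = 0 \<or> i = 1 \<or> i = 2 \<or> i = 3" using i by auto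
  ultimately show ?thesis using * by auto
qed

text \<open>For \<open>unique\<close>, coefficients in [0, 1) with sum 1 give a lattice point of T
  that is not a vertex. Cleanness then keeps it off the boundary, so it is the interior lattice
  point.\<close>

lemma one_point_group_bary_lattice:
  assumes "one_point_lattice_tetrahedron T"
  obtains v l where "inj_on v {..<4}" "vertices T = v ` {..<4}" "\<not> affine_dependent (v ` {..<4})"
    "v ` {..<4} \<subseteq> int_lattice" "one_point_group (bary_lattice v) l"
proof -
  have "3 simplex T" and int: "vertices T \<subseteq> int_lattice" and fr: "frontier T \<inter> int_lattice = vertices T"
    and ex1: "\<exists>!x. x \<in> interior T \<inter> int_lattice"
    using assms unfolding one_point_lattice_tetrahedron_def clean_tetrahedron_def lattice_tetrahedron_def by auto
  then obtain C where C: "\<not> affine_dependent C" "card C = 4" "T = convex hull C"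
    unfolding simplex_def by auto
  have fin: "finite C" using C(2) by (intro card_ge_0_finite) simp
  have vert: "vertices T = C"
    unfolding vertices_def C(3) using extreme_point_of_convex_hull_affine_independent[OF C(1)] by auto
  obtain w where w: "w \<in> interior T" "w \<in> int_lattice" using ex1 by auto
  then obtain u where u: "\<And>x. x \<in> C \<Longrightarrow> 0 < u x" "sum u C = 1" "(\<Sum>x\<in>C. u x *\<^sub>R x) = w"
    using interior_convex_hull_explicit_minimal[OF C(1)] C(2,3) by auto
  obtain xs where xs: "set xs = C" "distinct xs" using finite_distinct_list[OF fin] by blast
  \<comment> \<open>The vertices are numbered by increasing barycentric coordinate of the interior
    point, as \<open>l_mono\<close> demands.\<close>
  define ys where "ys = sort_key u xs"
  have ys: "set ys = C" "distinct ys" "sorted (map u ys)" unfolding ys_def using xs by auto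
  have len: "length ys = 4" using ys C(2) distinct_card by fastforce
  define v where "v i = ys ! i" for i
  define l where "l i = u (v i)" for i
  have bij: "bij_betw v {..<4} C" unfolding v_def using bij_betw_nth[OF ys(2)] len ys(1) by simp
  then have inj: "inj_on v {..<4}" and img: "v ` {..<4} = C" unfolding bij_betw_def by auto
  have reindex: "sum f C = (\<Sum>i<4. f (v i))" for f :: "real^3 \<Rightarrow> 'a::comm_monoid_add"
    using sum.reindex_bij_betw[OF bij, of f] by simp
  have v_int: "v i \<in> int_lattice" if "i < 4" for i using that img int vert by auto
  have det: "det (edge_matrix v) \<noteq> 0" using det_edge_matrix_neq_0[OF inj] C(1) img by simp
  have l_sum: "(\<Sum>i<4. l i) = 1" "(\<Sum>i<4. l i *\<^sub>R v i) = w"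
    using u(2,3) unfolding reindex l_def by auto
  have "one_point_group (bary_lattice v) l"
  proof
    show "(\<lambda>i. f i - g i) \<in> bary_lattice v" if "f \<in> bary_lattice v" "g \<in> bary_lattice v" for f g
      using that unfolding bary_lattice_def
      by (auto simp: sum_subtractf scaleR_diff_left intro: int_lattice_diff)
    show "g \<in> bary_lattice v" if "\<And>i. i < 4 \<Longrightarrow> g i \<in> \<int>" for g
      unfolding bary_lattice_def using that v_int
      by (auto intro!: Ints_sum int_lattice_sum int_lattice_scaleR)
    show "(\<Sum>i<4. g i) \<in> \<int>" if "g \<in> bary_lattice v" for g
      using that unfolding bary_lattice_def by simp
    show "\<exists>N>0. \<forall>g\<in>bary_lattice v. \<forall>i<4. real N * g i \<in> \<int>"
    proof -
      obtain d where d: "det (edge_matrix v) = of_int d"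
        using det_Ints[of "edge_matrix v"] edge_matrix_Ints[OF v_int] by (auto elim: Ints_cases)
      have "real (nat \<bar>d\<bar>) * g i \<in> \<int>" if "g \<in> bary_lattice v" "i < 4" for g i
        using det_mult_bary_Ints[OF v_int that] d by (cases "0 \<le> d") (auto simp: abs_if)
      moreover have "nat \<bar>d\<bar> > 0" using det d by simp
      ultimately show ?thesis by blast
    qed
    show "l \<in> bary_lattice v" using l_sum w unfolding bary_lattice_def by simp
    show "0 < l i" if "i < 4" for i using that img u(1) unfolding l_def by auto
    show "(\<Sum>i<4. l i) = 1" by (rule l_sum)
    show "l i \<le> l j" if "i \<le> j" "j < 4" for i j
      using sorted_nth_mono[OF ys(3) that(1)] that len unfolding l_def v_def by simp
    show "g i = l i" if g: "g \<in> bary_lattice v" and bnd: "\<And>i. i < 4 \<Longrightarrow> 0 \<le> g i \<and> g i < 1"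
      and g1: "(\<Sum>i<4. g i) = 1" and i: "i < 4" for g i
    proof -
      define x where "x = (\<Sum>i<4. g i *\<^sub>R v i)"
      have x_int: "x \<in> int_lattice" using g unfolding bary_lattice_def x_def by simp
      have "x \<in> T"
      proof -
        define U where "U y = g (inv_into {..<4} v y)" for y
        have "U (v i) = g i" if "i < 4" for i
          unfolding U_def using inv_into_f_f[OF inj, of i] that by simp
        then have "(\<forall>y\<in>C. 0 \<le> U y) \<and> sum U C = 1 \<and> (\<Sum>y\<in>C. U y *\<^sub>R y) = x"
          using bnd g1 img unfolding reindex x_def by auto
        then show ?thesis unfolding C(3) convex_hull_finite[OF fin] by blast
      qed
      moreover have "x \<notin> vertices T"
      proof
        assume "x \<in> vertices T"
        then obtain k where k: "k < 4" "x = v k" using vert img by auto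
        \<comment> \<open>The vertex \<open>v k\<close> also has the k-th unit vector as
          coefficients, so uniqueness would give \<open>g k = 1\<close>; the test
          \<open>k = k\<close> is that vector evaluated at k.\<close>
        have "g k = (if k = k then 1 else 0)"
          by (rule bary_unique[OF det _ _ k(1), of g "\<lambda>i. if i = k then 1 else 0"])
            (use g1 k x_def in \<open>simp_all add: if_distrib[of "\<lambda>c. c *\<^sub>R _"] cong: if_cong\<close>)
        then show False using bnd[OF k(1)] by simp
      qed
      then have "x \<notin> frontier T" using fr x_int by blast
      ultimately have "x \<in> interior T"
        unfolding frontier_def using closure_subset by blast
      then have "x = w" using ex1 w x_int by blast
      then show "g i = l i"
        using bary_unique[OF det, of g l] g1 l_sum i unfolding x_def by simp
    qed
  qed
  then show ?thesis
    by (rule that[rotated -1]) (simp_all add: inj vert img C(1) int[unfolded vert])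
qed

section \<open>Equivalence from equality of coefficient groups\<close>

lemma edge_matrix_map:
  assumes "det (edge_matrix v) \<noteq> 0"
  obtains M where "M ** edge_matrix v = edge_matrix t" "\<And>i. i < 4 \<Longrightarrow> M *v v i + (t 0 - M *v v 0) = t i"
proof -
  obtain A' where A': "A' ** edge_matrix v = mat 1"
    using assms invertible_det_nz[of "edge_matrix v"] by (auto simp: invertible_left_inverse)
  define M where "M = edge_matrix t ** A'"
  have M: "M ** edge_matrix v = edge_matrix t"
    unfolding M_def by (simp add: matrix_mul_assoc[symmetric] A')
  have "M *v (edge_matrix v *v axis k 1) = edge_matrix t *v axis k 1" for k
    by (simp add: matrix_vector_mul_assoc M)
  from this[of 1] this[of 2] this[of 3]
  have "M *v (v 1 - v 0) = t 1 - t 0" "M *v (v 2 - v 0) = t 2 - t 0" "M *v (v 3 - v 0) = t 3 - t 0"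
    unfolding edge_matrix_mult_axis by auto
  then have "M *v v i + (t 0 - M *v v 0) = t i" if "i < 4" for i
  proof -
    have "i = 0 \<or> i = 1 \<or> i = 2 \<or> i = 3" using that by auto
    then show ?thesis
      using \<open>M *v (v 1 - v 0) = t 1 - t 0\<close> \<open>M *v (v 2 - v 0) = t 2 - t 0\<close> \<open>M *v (v 3 - v 0) = t 3 - t 0\<close>
      by (auto simp: matrix_vector_mult_diff_distrib algebra_simps)
  qed
  with M that show thesis by blast
qed

text \<open>Column j of M is the image of the j-th unit vector. That vector is a combination of the
  \<open>v i\<close> with coefficient sum 0; by \<open>sub\<close>, the same combination of the
  \<open>t i\<close> is a lattice point.\<close>

lemma edge_matrix_map_Ints:
  assumes v: "det (edge_matrix v) \<noteq> 0" "\<And>i. i < 4 \<Longrightarrow> v i \<in> int_lattice"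
    and t: "\<And>i. i < 4 \<Longrightarrow> t i \<in> int_lattice"
    and M: "M ** edge_matrix v = edge_matrix t" and sub: "bary_lattice v \<subseteq> bary_lattice t"
  shows "M $ i $ j \<in> \<int>"
proof -
  obtain A' where A': "edge_matrix v ** A' = mat 1"
    using v(1) invertible_det_nz[of "edge_matrix v"] by (auto simp: invertible_right_inverse)
  define c where "c = A' *v axis j 1"
  define g where "g i = (if i = 0 then - (c $ 1 + c $ 2 + c $ 3) else if i = 1 then c $ 1
      else if i = 2 then c $ 2 else c $ 3)" for i :: nat
  have g0: "(\<Sum>i<4. g i) = 0" by (simp add: sum4 g_def)
  have c: "vector [g 1, g 2, g 3] = c" by (simp add: g_def vec_eq_iff forall_3)
  have sum: "edge_matrix x *v c = (\<Sum>i<4. g i *\<^sub>R x i)" for x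
    using edge_matrix_mult_bary[of x g] unfolding g0 c by simp
  have ax: "edge_matrix v *v c = axis j 1"
    unfolding c_def by (simp add: matrix_vector_mul_assoc A')
  then have "(\<Sum>i<4. g i *\<^sub>R v i) \<in> int_lattice"
    unfolding sum[symmetric] by (simp add: int_lattice_def axis_def)
  then have "g \<in> bary_lattice v" using g0 by (simp add: bary_lattice_def)
  with sub have "g \<in> bary_lattice t" by blast
  then have "edge_matrix t *v c \<in> int_lattice" unfolding sum bary_lattice_def by simp
  moreover have "edge_matrix t *v c = M *v axis j 1"
    unfolding ax[symmetric] M[symmetric] by (simp add: matrix_vector_mul_assoc)
  ultimately have "M *v axis j 1 \<in> int_lattice" by simp
  then have "(M *v axis j 1) $ i \<in> \<int>" unfolding int_lattice_def by simp
  then show ?thesis by (simp add: matrix_vector_mult_basis column_def)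
qed

lemma lattice_equivalentI:
  assumes S: "vertices S = v ` {..<4}" "det (edge_matrix v) \<noteq> 0" "\<And>i. i < 4 \<Longrightarrow> v i \<in> int_lattice"
    and T: "vertices T = t ` {..<4}" "det (edge_matrix t) \<noteq> 0" "\<And>i. i < 4 \<Longrightarrow> t i \<in> int_lattice"
    and eq: "bary_lattice v = bary_lattice t"
  shows "lattice_equivalent S T"
proof -
  obtain M where M: "M ** edge_matrix v = edge_matrix t" "\<And>i. i < 4 \<Longrightarrow> M *v v i + (t 0 - M *v v 0) = t i"
    using edge_matrix_map[OF S(2)] by blast
  obtain N where N: "N ** edge_matrix t = edge_matrix v"
    using edge_matrix_map[OF T(2)] by blast
  have M_int: "M $ i $ j \<in> \<int>" for i j
    using edge_matrix_map_Ints[OF S(2,3) T(3) M(1)] eq by simp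
  have N_int: "N $ i $ j \<in> \<int>" for i j
    using edge_matrix_map_Ints[OF T(2,3) S(3) N] eq by simp
  \<comment> \<open>N maps the edges back, so the two integral determinants are mutually
    inverse.\<close>
  have "det N * (det M * det (edge_matrix v)) = det (edge_matrix v)"
    unfolding det_mul[symmetric] M(1) N ..
  then have "det N * det M = 1" using S(2) by simp
  moreover obtain p q :: int where pq: "det N = p" "det M = q"
    using det_Ints[of M] det_Ints[of N] M_int N_int by (auto elim!: Ints_cases)
  ultimately have "p * q = 1" by (metis of_int_eq_1_iff of_int_mult)
  then have "q = 1 \<or> q = - 1" by (auto simp: zmult_eq_1_iff)
  then have det_M: "det M = 1 \<or> det M = - 1" using pq by auto
  have "M *v v 0 \<in> int_lattice"
    unfolding int_lattice_def matrix_vector_mult_def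
    using M_int S(3)[of 0] by (auto simp: int_lattice_def intro!: Ints_sum)
  then have "t 0 - M *v v 0 \<in> int_lattice" using T(3)[of 0] by (simp add: int_lattice_diff)
  moreover have "(\<lambda>x. M *v x + (t 0 - M *v v 0)) ` vertices S = vertices T"
    unfolding S(1) T(1) image_image using M(2) by (intro image_cong) auto
  ultimately show ?thesis
    unfolding lattice_equivalent_def using M_int det_M by blast
qed

section \<open>The tetrahedra of the list\<close>

definition tetra_vertex :: "int \<Rightarrow> int \<Rightarrow> int \<Rightarrow> nat \<Rightarrow> real^3" where
  "tetra_vertex a b n i = [vector [0, 0, 0], vector [1, 0, 0], vector [0, 1, 0],
      vector [of_int a, of_int b, of_int n]] ! i"

lemma tetra_vertex_simps [simp]:
  "tetra_vertex a b n 0 = vector [0, 0, 0]" "tetra_vertex a b n (Suc 0) = vector [1, 0, 0]"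
  "tetra_vertex a b n 2 = vector [0, 1, 0]" "tetra_vertex a b n 3 = vector [of_int a, of_int b, of_int n]"
  by (simp_all add: tetra_vertex_def)

lemma det_edge_matrix_tetra: "det (edge_matrix (tetra_vertex a b n)) = of_int n"
  by (simp add: det_3 edge_matrix_def)

lemma tetra_vertex_image: "tetra_vertex a b n ` {..<4} = {vector [0, 0, 0], vector [1, 0, 0], vector [0, 1, 0],
      vector [of_int a, of_int b, of_int n]}"
proof -
  have "{..<4::nat} = {0, Suc 0, 2, 3}" by auto
  then show ?thesis by simp
qed

lemma tetra_vertex_int: "i < 4 \<Longrightarrow> tetra_vertex a b n i \<in> int_lattice"
proof -
  assume "i < 4"
  then have "i = 0 \<or> i = Suc 0 \<or> i = 2 \<or> i = 3" by auto
  then show ?thesis by (auto simp: int_lattice_def forall_3)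
qed

lemma vertices_tetra:
  assumes "n \<noteq> 0"
  shows "vertices (tetra a b n) = tetra_vertex a b n ` {..<4}"
proof -
  let ?t = "tetra_vertex a b n"
  have "\<not> affine_dependent (?t ` {..<4})"
  proof
    assume dep: "affine_dependent (?t ` {..<4})"
    have neq: "?t 0 \<noteq> ?t 1" "?t 0 \<noteq> ?t 2" "?t 0 \<noteq> ?t 3" "?t 1 \<noteq> ?t 2" "?t 1 \<noteq> ?t 3" "?t 2 \<noteq> ?t 3"
      using assms by (auto simp: vec_eq_iff forall_3)
    have img: "?t ` {..<4} = {?t 0, ?t 1, ?t 2, ?t 3}" using tetra_vertex_image by simp
    obtain U where U: "sum U (?t ` {..<4}) = 0" "\<exists>x\<in>?t ` {..<4}. U x \<noteq> 0"
      "(\<Sum>x\<in>?t ` {..<4}. U x *\<^sub>R x) = 0"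
      using dep by (subst (asm) affine_dependent_explicit_finite) auto
    have "U (?t 0) + U (?t 1) + U (?t 2) + U (?t 3) = 0"
      using U(1) neq unfolding img by (simp add: add.assoc)
    moreover have "U (?t 0) *\<^sub>R ?t 0 + U (?t 1) *\<^sub>R ?t 1 + U (?t 2) *\<^sub>R ?t 2 + U (?t 3) *\<^sub>R ?t 3 = 0"
      using U(3) neq unfolding img by (simp add: add.assoc)
    then have "U (?t 1) + U (?t 3) * a = 0" "U (?t 2) + U (?t 3) * b = 0" "U (?t 3) * n = 0"
      by (simp_all add: vec_eq_iff forall_3)
    ultimately have "U (?t 0) = 0 \<and> U (?t 1) = 0 \<and> U (?t 2) = 0 \<and> U (?t 3) = 0"
      using assms by simp
    then show False using U(2) unfolding img by blast
  qed
  then show ?thesis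
    unfolding vertices_def tetra_def tetra_vertex_image
    using extreme_point_of_convex_hull_affine_independent by blast
qed

lemma bary_lattice_tetra:
  "g \<in> bary_lattice (tetra_vertex a b n) \<longleftrightarrow> (\<Sum>i<4. g i) \<in> \<int> \<and>
     g 1 + of_int a * g 3 \<in> \<int> \<and> g 2 + of_int b * g 3 \<in> \<int> \<and> of_int n * g 3 \<in> \<int>"
  unfolding bary_lattice_def by (simp add: sum4 int_lattice_def forall_3 mult.commute)


lemma bary_lattice_permute:
  assumes "bij_betw p {..<4} {..<4}"
  shows "f \<in> bary_lattice (v \<circ> p) \<longleftrightarrow> f \<circ> inv_into {..<4} p \<in> bary_lattice v"
proof -
  have inv: "inv_into {..<4} p (p i) = i" if "i < 4" for i
    using assms that by (simp add: bij_betw_def)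
  have "(\<Sum>i<4. f (inv_into {..<4} p i)) = (\<Sum>i<4. f i)"
    using sum.reindex_bij_betw[OF assms, of "\<lambda>i. f (inv_into {..<4} p i)"] inv by simp
  moreover have "(\<Sum>i<4. f (inv_into {..<4} p i) *\<^sub>R v i) = (\<Sum>i<4. f i *\<^sub>R v (p i))"
    using sum.reindex_bij_betw[OF assms, of "\<lambda>i. f (inv_into {..<4} p i) *\<^sub>R v i"] inv by simp
  ultimately show ?thesis by (simp add: bary_lattice_def)
qed

text \<open>The first two divisibilities put the permuted generator y into the group of the standard
  tetrahedron. The third makes r an inverse of the numerator of \<open>y 3\<close> modulo n, so
  coordinate 3 of any element there is matched by a multiple of y, and the other coordinates
  follow.\<close>

lemma bary_lattice_eq_tetra:
  fixes a b n r :: int and us :: "int list"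
  assumes G: "one_point_group (bary_lattice v) l" and x: "x \<in> bary_lattice v"
    and gen: "\<And>f. f \<in> bary_lattice v \<Longrightarrow> \<exists>t::int. \<forall>i<4. f i - of_int t * x i \<in> \<int>"
    and x_eq: "\<And>i. i < 4 \<Longrightarrow> x i = of_int (us ! i) / of_int n" and n: "0 < n"
    and p: "bij_betw p {..<4} {..<4}"
    and dvd: "n dvd us ! p 1 + a * us ! p 3" "n dvd us ! p 2 + b * us ! p 3" "n dvd r * us ! p 3 - 1"
  shows "bary_lattice (v \<circ> p) = bary_lattice (tetra_vertex a b n)"
proof -
  interpret one_point_group "bary_lattice v" l by (rule G)
  let ?q = "inv_into {..<4} p"
  have q: "?q (p i) = i" if "i < 4" for i using p that by (simp add: bij_betw_def)
  have p_less: "p i < 4" if "i < 4" for i using p that by (auto simp: bij_betw_def)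
  define y where "y = x \<circ> p"
  have y_eq: "y i = of_int (us ! p i) / of_int n" if "i < 4" for i
    unfolding y_def using x_eq[OF p_less[OF that]] by simp
  have Ints: "of_int k / of_int n \<in> (\<int> :: real set)" if "n dvd k" for k
    using that n by (auto elim!: dvdE)
  have y1: "y 1 + of_int a * y 3 \<in> \<int>" using Ints[OF dvd(1)] by (simp add: y_eq add_divide_distrib)
  have y2: "y 2 + of_int b * y 3 \<in> \<int>" using Ints[OF dvd(2)] by (simp add: y_eq add_divide_distrib)
  have y3: "of_int n * y 3 \<in> \<int>" using n by (simp add: y_eq)
  have y_sum: "(\<Sum>i<4. y i) \<in> \<int>"
    using sum_Ints[OF x] sum.reindex_bij_betw[OF p, of x] by (simp add: y_def)
  have combine: "u + of_int c * w + of_int d * z \<in> \<int>" if "u \<in> \<int>" "w \<in> \<int>" "z \<in> \<int>"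
    for u w z :: real and c d
    using that by simp
  show ?thesis
  proof (intro set_eqI iffI)
    fix f assume f: "f \<in> bary_lattice (v \<circ> p)"
    then have f': "f \<circ> ?q \<in> bary_lattice v" using bary_lattice_permute[OF p] by blast
    obtain t :: int where "\<forall>i<4. (f \<circ> ?q) i - of_int t * x i \<in> \<int>" using gen[OF f'] by blast
    then have t: "f i - of_int t * y i \<in> \<int>" if "i < 4" for i
      using p_less[OF that] q[OF that] by (metis comp_apply y_def)
    have "f 1 + of_int a * f 3 = (f 1 - of_int t * y 1) + of_int a * (f 3 - of_int t * y 3)
        + of_int t * (y 1 + of_int a * y 3)" by (simp add: algebra_simps)
    also have "\<dots> \<in> \<int>" using t[of 1] t[of 3] y1 by (intro combine) simp_all
    finally have 1: "f 1 + of_int a * f 3 \<in> \<int>" .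
    have "f 2 + of_int b * f 3 = (f 2 - of_int t * y 2) + of_int b * (f 3 - of_int t * y 3)
        + of_int t * (y 2 + of_int b * y 3)" by (simp add: algebra_simps)
    also have "\<dots> \<in> \<int>" using t[of 2] t[of 3] y2 by (intro combine) simp_all
    finally have 2: "f 2 + of_int b * f 3 \<in> \<int>" .
    have "of_int n * f 3 = 0 + of_int n * (f 3 - of_int t * y 3) + of_int t * (of_int n * y 3)"
      by (simp add: algebra_simps)
    also have "\<dots> \<in> \<int>" using t[of 3] y3 by (intro combine) simp_all
    finally have 3: "of_int n * f 3 \<in> \<int>" .
    have "(\<Sum>i<4. f i) \<in> \<int>" using f by (simp add: bary_lattice_def)
    with 1 2 3 show "f \<in> bary_lattice (tetra_vertex a b n)"
      unfolding bary_lattice_tetra by blast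
  next
    fix f assume "f \<in> bary_lattice (tetra_vertex a b n)"
    then have f: "(\<Sum>i<4. f i) \<in> \<int>" "f 1 + of_int a * f 3 \<in> \<int>" "f 2 + of_int b * f 3 \<in> \<int>"
      "of_int n * f 3 \<in> \<int>" unfolding bary_lattice_tetra by auto
    from f(4) obtain k :: int where k: "of_int n * f 3 = of_int k" by (elim Ints_cases)
    define t where "t = k * r"
    have "f 3 - of_int t * y 3 = - of_int k * (of_int (r * us ! p 3 - 1) / of_int n)"
      using k n by (simp add: y_eq t_def field_simps)
    also have "\<dots> \<in> \<int>" using Ints[OF dvd(3)] by (intro Ints_mult) auto
    finally have 3: "f 3 - of_int t * y 3 \<in> \<int>" .
    have "f 1 - of_int t * y 1 = (f 1 + of_int a * f 3) + of_int (- a) * (f 3 - of_int t * y 3)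
        + of_int (- t) * (y 1 + of_int a * y 3)" by (simp add: algebra_simps)
    also have "\<dots> \<in> \<int>" using 3 f(2) y1 by (intro combine)
    finally have 1: "f 1 - of_int t * y 1 \<in> \<int>" .
    have "f 2 - of_int t * y 2 = (f 2 + of_int b * f 3) + of_int (- b) * (f 3 - of_int t * y 3)
        + of_int (- t) * (y 2 + of_int b * y 3)" by (simp add: algebra_simps)
    also have "\<dots> \<in> \<int>" using 3 f(3) y2 by (intro combine)
    finally have 2: "f 2 - of_int t * y 2 \<in> \<int>" .
    \<comment> \<open>Coordinate 0 is recovered from the integral sums of f and y.\<close>
    have "f 0 - of_int t * y 0 = (\<Sum>i<4. f i) + of_int (- t) * (\<Sum>i<4. y i) +
        of_int (- 1) * ((f 1 - of_int t * y 1) + of_int 1 * (f 2 - of_int t * y 2) +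
          of_int 1 * (f 3 - of_int t * y 3))" by (simp add: sum4 algebra_simps)
    also have "\<dots> \<in> \<int>" using 1 2 3 f(1) y_sum by (intro combine)
    finally have 0: "f 0 - of_int t * y 0 \<in> \<int>" .
    have all: "f i - of_int t * y i \<in> \<int>" if "i < 4" for i
    proof -
      have "i = 0 \<or> i = 1 \<or> i = 2 \<or> i = 3" using that by auto
      then show ?thesis using 0 1 2 3 by auto
    qed
    have "(f \<circ> ?q) i - of_int t * x i \<in> \<int>" if "i < 4" for i
    proof -
      have "i \<in> p ` {..<4}" using p that unfolding bij_betw_def by simp
      then obtain j where "j < 4" "i = p j" by auto
      then show ?thesis using all[of j] q[of j] by (simp add: y_def)
    qed
    then have "f \<circ> ?q \<in> bary_lattice v" using cong_in[OF scale_in[OF x]] by blast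
    then show "f \<in> bary_lattice (v \<circ> p)" using bary_lattice_permute[OF p] by blast
  qed
qed

text \<open>\<open>ps\<close> reorders the vertices so that the entry at \<open>ps ! 3\<close> is
  invertible modulo n, with inverse r; then a and b are the negated quotients of the entries at
  \<open>ps ! 1\<close> and \<open>ps ! 2\<close> by it. In the exceptional cases that entry is 1,
  and 17 and 13 give a = 3 and b = 7.\<close>

lemma normal_form:
  assumes "us \<in> weights \<and> n = sum_list us \<or> us \<in> exceptional \<and> n = 20"
  obtains a b ps r where "(a, b, n) \<in> {(3, 3, 4), (2, 2, 5), (2, 4, 7), (2, 6, 11), (2, 7, 13),
           (2, 9, 17), (2, 13, 19), (3, 7, 20)}"
    "distinct ps" "length ps = 4" "set ps = {..<4::nat}"
    "n dvd us ! (ps ! 1) + a * us ! (ps ! 3)" "n dvd us ! (ps ! 2) + b * us ! (ps ! 3)"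
    "n dvd r * us ! (ps ! 3) - 1"
proof -
  have I: "{..<4::nat} = {0, 1, 2, 3}" by auto
  from assms show ?thesis
    unfolding weights_def exceptional_def
    apply (elim disjE conjE insertE emptyE)
    subgoal by (rule that[of 3 3 "[0,1,2,3]" 1]) (auto simp: I)
    subgoal by (rule that[of 2 2 "[0,1,2,3]" 3]) (auto simp: I)
    subgoal by (rule that[of 2 4 "[0,1,2,3]" 5]) (auto simp: I)
    subgoal by (rule that[of 2 6 "[1,0,2,3]" 9]) (auto simp: I)
    subgoal by (rule that[of 2 7 "[0,1,2,3]" 8]) (auto simp: I)
    subgoal by (rule that[of 2 9 "[0,1,2,3]" 5]) (auto simp: I)
    subgoal by (rule that[of 2 13 "[0,2,1,3]" 11]) (auto simp: I)
    subgoal by (rule that[of 3 7 "[1,3,2,0]" 1]) (auto simp: I)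
    subgoal by (rule that[of 3 7 "[1,2,3,0]" 1]) (auto simp: I)
    subgoal by (rule that[of 3 7 "[2,3,1,0]" 1]) (auto simp: I)
    subgoal by (rule that[of 3 7 "[3,2,1,0]" 1]) (auto simp: I)
    subgoal by (rule that[of 3 7 "[2,1,3,0]" 1]) (auto simp: I)
    subgoal by (rule that[of 3 7 "[3,1,2,0]" 1]) (auto simp: I)
    done
qed

theorem theorem7:
  fixes T :: "(real^3) set"
  assumes "one_point_lattice_tetrahedron T"
  shows "\<exists>(a, b, n) \<in> {(3, 3, 4), (2, 2, 5), (2, 4, 7), (2, 6, 11), (2, 7, 13),
           (2, 9, 17), (2, 13, 19), (3, 7, 20)}. lattice_equivalent T (tetra a b n)"
proof -
  obtain v l where v: "inj_on v {..<4}" "vertices T = v ` {..<4}" "\<not> affine_dependent (v ` {..<4})"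
    "v ` {..<4} \<subseteq> int_lattice" and G: "one_point_group (bary_lattice v) l"
    using one_point_group_bary_lattice[OF assms] by metis
  obtain x where x: "x \<in> bary_lattice v"
    and gen: "\<And>f. f \<in> bary_lattice v \<Longrightarrow> \<exists>t::int. \<forall>i<4. f i - of_int t * x i \<in> \<int>"
    and cases: "(\<exists>us\<in>weights. \<forall>i<4. x i = of_int (us ! i) / of_int (sum_list us)) \<or>
     (\<exists>as\<in>exceptional. \<forall>i<4. x i = of_int (as ! i) / 20)"
    using one_point_group.generator_cases[OF G] by metis
  obtain us n where us: "us \<in> weights \<and> n = sum_list us \<or> us \<in> exceptional \<and> n = 20"
    and x_eq: "\<And>i. i < 4 \<Longrightarrow> x i = of_int (us ! i) / of_int n"
    using cases by (metis of_int_numeral)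
  obtain a b ps r where abn: "(a, b, n) \<in> {(3, 3, 4), (2, 2, 5), (2, 4, 7), (2, 6, 11), (2, 7, 13),
           (2, 9, 17), (2, 13, 19), (3, 7, 20)}"
    and ps: "distinct ps" "length ps = 4" "set ps = {..<4::nat}"
    and dvd: "n dvd us ! (ps ! 1) + a * us ! (ps ! 3)" "n dvd us ! (ps ! 2) + b * us ! (ps ! 3)"
      "n dvd r * us ! (ps ! 3) - 1"
    using normal_form[OF us] by metis
  \<comment> \<open>Reordering the vertices changes neither the vertex set nor the equivalence
    class.\<close>
  define p where "p = (!) ps"
  have p: "bij_betw p {..<4} {..<4}" unfolding p_def using bij_betw_nth[OF ps(1)] ps by simp
  have n: "0 < n" using abn by auto
  have inj: "inj_on (v \<circ> p) {..<4}"
    using p v(1) unfolding bij_betw_def by (intro comp_inj_on) simp_all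
  have img: "(v \<circ> p) ` {..<4} = v ` {..<4}"
    using p unfolding bij_betw_def by (simp only: image_comp[symmetric])
  have "lattice_equivalent T (tetra a b n)"
  proof (rule lattice_equivalentI)
    show "vertices T = (v \<circ> p) ` {..<4}" unfolding img v(2) ..
    show "det (edge_matrix (v \<circ> p)) \<noteq> 0" using det_edge_matrix_neq_0[OF inj] v(3) img by simp
    show "(v \<circ> p) i \<in> int_lattice" if "i < 4" for i using img v(4) that by blast
    show "vertices (tetra a b n) = tetra_vertex a b n ` {..<4}" using vertices_tetra n by simp
    show "det (edge_matrix (tetra_vertex a b n)) \<noteq> 0" using n by (simp add: det_edge_matrix_tetra)
    show "tetra_vertex a b n i \<in> int_lattice" if "i < 4" for i using tetra_vertex_int that .
    show "bary_lattice (v \<circ> p) = bary_lattice (tetra_vertex a b n)"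
      by (rule bary_lattice_eq_tetra[OF G x gen x_eq n p]) (use dvd in \<open>simp_all add: p_def\<close>)
  qed
  with abn show ?thesis by blast
qed

end
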